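(* Let $A\in\bigwedge^p X$ and $B\in\bigwedge^q X$ be nonzero blades. Then $A\lrcorner B=0$ if and only if $[A]$ is partially orthogonal to $[B]$, i.e. $[B]^\perp\cap[A]\neq\{0\}$. If $A\lrcorner B\neq 0$, then $A\lrcorner B$ is the only $(q-p)$-blade such that: (i) $[A\lrcorner B]=[A]^\perp\cap[B]$; (ii) $\|A\lrcorner B\|=\|P_BA\|\,\|B\|=\|A\|\,\|B\|\cos\Theta_{[A],[B]}$; (iii) $(P_BA)\wedge(A\lrcorner B)$ has the orientation of $B$. (That is, $A\lrcorner B$ is a $(q-p)$-blade satisfying (i)--(iii), and any $(q-p)$-blade $C$ satisfying (i)--(iii) with $C$ in place of $A\lrcorner B$ equals $A\lrcorner B$.)
   Context: $X$ is an $n$-dimensional Euclidean (real) or Hermitian (complex) vector space with inner product $\langle\cdot,\cdot\rangle$, conjugate-linear in the left entry in the complex case. $\bigwedge X=\bigoplus_p\bigwedge^pX$ is its exterior algebra, with inner product given by $\langle v_1\wedge\cdots\wedge v_p,w_1\wedge\cdots\wedge w_p\rangle=\det(\langle v_i,w_j\rangle)$, with distinct $\bigwedge^pX$'s orthogonal, $\langle\kappa,\lambda\rangle=\bar\kappa\lambda$ for scalars, extended (sesqui)linearly; $\|M\|=\sqrt{\langle M,M\rangle}$. Left contraction: for $M,N\in\bigwedge X$, $M\lrcorner N$ is the unique element of $\bigwedge X$ with $\langle L,M\lrcorner N\rangle=\langle M\wedge L,N\rangle$ for all $L\in\bigwedge X$. A $p$-blade is an element $B=v_1\wedge\cdots\wedge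 v_p$ with $v_i\in X$ (a $0$-blade is a scalar, and $0$ is a $p$-blade for all $p$). If $B\neq0$ its space is $[B]=\mathrm{span}\{v_1,\dots,v_p\}$; for a scalar $\lambda$, $[\lambda]=\{0\}$. Two nonzero blades $A,B$ have the same orientation if $A=\lambda B$ for some real $\lambda>0$. $P_V$ is the orthogonal projection $X\to V$ onto a subspace $V\subset X$, extended to $\bigwedge X$ as an outermorphism (linear, $P_V(M\wedge N)=P_VM\wedge P_VN$, $P_V(1)=1$), and $P_B=P_{[B]}$. For subspaces $V=[A]$, $W=[B]$ ($A,B$ nonzero blades), the asymmetric angle is $\Theta_{V,W}=\cos^{-1}\frac{\|P_WA\|}{\|A\|}$ (depends only on $V,W$). *)

theory Defs
  imports "Jordan_Normal_Form.Determinant" "HOL-Library.Function_Algebras"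
begin

section \<open>Scalars: the real and the complex case at once\<close>

text \<open>The last axiom forces such a field to be a copy of \<open>\<real>\<close> (with trivial conjugation) or of
  \<open>\<complex>\<close> (with complex conjugation); see the classification lemma below.\<close>

class real_or_complex = real_normed_field + conjugatable_field +
  assumes mult_conjugate_scaleR: "x * conjugate x = (norm x)\<^sup>2 *\<^sub>R 1"

instance real :: real_or_complex
  by standard (simp add: power2_eq_square)

instance complex :: real_or_complex
  by standard (simp add: complex_mult_cnj cmod_power2 scaleR_conv_of_real)

lemma mult_conjugate_norm: "x * conjugate x = of_real ((norm (x::'k::real_or_complex))\<^sup>2)"
  by (simp add: mult_conjugate_scaleR of_real_def)

lemma conjugate_one [simp]: "conjugate (1::'k::real_or_complex) = 1"
  using mult_conjugate_norm[of "1::'k"] by simp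

lemma conjugate_of_real [simp]: "conjugate (of_real r :: 'k::real_or_complex) = of_real r"
proof (cases "r = 0")
  case False
  have "of_real r * conjugate (of_real r :: 'k) = of_real r * of_real r"
    using mult_conjugate_norm[of "of_real r :: 'k"] by (simp add: power2_eq_square flip: of_real_mult)
  then show ?thesis using False by simp
qed simp

lemma add_conjugate_Reals: "x + conjugate x \<in> (\<real> :: 'k::real_or_complex set)"
proof -
  have "(1 + x) * conjugate (1 + x) = 1 + (x + conjugate x) + x * conjugate x"
    by (simp add: conjugate_dist_add algebra_simps)
  then have "x + conjugate x = of_real ((norm (1 + x))\<^sup>2 - 1 - (norm x)\<^sup>2)"
    unfolding mult_conjugate_norm by (simp add: algebra_simps)
  then show ?thesis by (metis Reals_of_real)
qed

lemma conjugate_eq_imp_Reals: "conjugate x = x \<Longrightarrow> x \<in> (\<real> :: 'k::real_or_complex set)"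
proof -
  assume "conjugate x = x"
  then have "x + x \<in> \<real>" using add_conjugate_Reals[of x] by simp
  then have "(x + x) / 2 \<in> \<real>" by (rule Reals_divide) simp
  then show ?thesis by simp
qed

lemma real_or_complex_cases:
  "(\<forall>x :: 'k::real_or_complex. x \<in> \<real> \<and> conjugate x = x) \<or>
   (\<exists>j :: 'k. j * j = -1 \<and> conjugate j = - j \<and>
      (\<forall>x. \<exists>a b. x = of_real a + of_real b * j))"
proof (cases "\<forall>x :: 'k. conjugate x = x")
  case True
  then show ?thesis using conjugate_eq_imp_Reals by blast
next
  case False
  then obtain z :: 'k where z: "conjugate z \<noteq> z" by blast
  define y where "y = z - conjugate z"
  have y0: "y \<noteq> 0" using z by (simp add: y_def)
  have cy: "conjugate y = - y"
    using conjugate_dist_add[of z "- conjugate z"] by (simp add: y_def conjugate_neg)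
  have yy: "y * y = - of_real ((norm y)\<^sup>2)" using mult_conjugate_norm[of y] cy
    by (metis minus_minus mult_minus_right)
  define j where "j = of_real (inverse (norm y)) * y"
  have "j * j = (of_real (inverse (norm y)) * of_real (inverse (norm y))) * (y * y)"
    by (simp add: j_def)
  also have "\<dots> = - of_real ((inverse (norm y) * inverse (norm y)) * (norm y)\<^sup>2)"
    unfolding yy by simp
  also have "(inverse (norm y) * inverse (norm y)) * (norm y)\<^sup>2 = 1"
    using y0 by (simp add: power2_eq_square field_simps)
  finally have jj: "j * j = -1" by simp
  have cj: "conjugate j = - j" unfolding j_def conjugate_dist_mul cy conjugate_of_real by simp
  have "\<exists>a b. x = of_real a + of_real b * j" for x
  proof -
    define s where "s = x - conjugate x"
    have "conjugate s = - s"
      using conjugate_dist_add[of x "- conjugate x"] by (simp add: s_def conjugate_neg)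
    then have "s * j \<in> \<real>" by (intro conjugate_eq_imp_Reals) (simp add: conjugate_dist_mul cj)
    then obtain b where b: "s * j = of_real b" by (auto elim: Reals_cases)
    have "s = - ((s * j) * j)" by (simp add: mult.assoc jj)
    then have s: "s = - (of_real b * j)" using b by simp
    obtain a where a: "x + conjugate x = of_real a"
      using add_conjugate_Reals by (auto elim: Reals_cases)
    have "x = ((x + conjugate x) + s) / 2" by (simp add: s_def)
    also have "\<dots> = of_real (a / 2) + of_real (- b / 2) * j"
      unfolding a s by (simp add: diff_divide_distrib)
    finally show ?thesis by blast
  qed
  then show ?thesis using jj cj by blast
qed

section \<open>The space \<open>X\<close>\<close>

locale hermitian_space = finite_dimensional_vector_space scale Basis
  for scale :: "'k::real_or_complex \<Rightarrow> 'a::ab_group_add \<Rightarrow> 'a" and Basis :: "'a set" +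
  fixes ip :: "'a \<Rightarrow> 'a \<Rightarrow> 'k"
  assumes ip_add_right: "ip x (y + z) = ip x y + ip x z"
    and ip_scale_right: "ip x (scale c y) = c * ip x y"
    and ip_commute: "ip y x = conjugate (ip x y)"
    and ip_pos: "x \<noteq> 0 \<Longrightarrow> \<exists>r>0. ip x x = of_real r"

definition orth_compl :: "('a \<Rightarrow> 'a \<Rightarrow> 'k::zero) \<Rightarrow> 'a set \<Rightarrow> 'a set" where
  "orth_compl ip V = {x. \<forall>v\<in>V. ip v x = 0}"

definition partially_orthogonal ::
    "('a::zero \<Rightarrow> 'a \<Rightarrow> 'k::zero) \<Rightarrow> 'a set \<Rightarrow> 'a set \<Rightarrow> bool" where
  "partially_orthogonal ip V W \<longleftrightarrow> orth_compl ip W \<inter> V \<noteq> {0}"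

definition orth_proj :: "('a::ab_group_add \<Rightarrow> 'a \<Rightarrow> 'k::zero) \<Rightarrow> 'a set \<Rightarrow> 'a \<Rightarrow> 'a" where
  "orth_proj ip V x = (THE v. v \<in> V \<and> x - v \<in> orth_compl ip V)"

section \<open>The exterior algebra of \<open>X\<close>\<close>

text \<open>A function on lists packs together one function on \<open>X\<^sup>p\<close> for each \<open>p\<close>; it is in
  \<open>alt_forms\<close> if all of these are multilinear and alternating.

  The product \<open>v\<^sub>1 \<and> \<dots> \<and> v\<^sub>p\<close> is encoded as evaluation at \<open>(v\<^sub>1, \<dots>, v\<^sub>p)\<close> of alternating
  forms, and \<open>\<And>X\<close> is the linear span of these evaluations. So the relations among products are
  exactly those that every alternating multilinear form respects, which is the universal
  property of \<open>\<And>X\<close>. In other words \<open>\<And>X\<close> is realised inside the dual of the space of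
  alternating forms. Values at non-alternating functions are irrelevant and set to \<open>0\<close>, so that
  equality in \<open>\<And>X\<close> is equality of functions.\<close>

type_synonym ('k, 'a) multivector = "('a list \<Rightarrow> 'k) \<Rightarrow> 'k"

definition alt_forms ::
    "('k::field \<Rightarrow> 'a::ab_group_add \<Rightarrow> 'a) \<Rightarrow> ('a list \<Rightarrow> 'k) set" where
  "alt_forms scale = {\<omega>.
     (\<forall>us ws. Vector_Spaces.linear scale (*) (\<lambda>v. \<omega> (us @ v # ws))) \<and>
     (\<forall>vs. \<not> distinct vs \<longrightarrow> \<omega> vs = 0)}"

definition vprod ::
    "('k::field \<Rightarrow> 'a::ab_group_add \<Rightarrow> 'a) \<Rightarrow> 'a list \<Rightarrow> ('k, 'a) multivector" where
  "vprod scale vs = (\<lambda>\<omega>. if \<omega> \<in> alt_forms scale then \<omega> vs else 0)"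

definition escale :: "'k::field \<Rightarrow> ('k, 'a) multivector \<Rightarrow> ('k, 'a) multivector" where
  "escale c M = (\<lambda>\<omega>. c * M \<omega>)"

definition ext_alg ::
    "('k::field \<Rightarrow> 'a::ab_group_add \<Rightarrow> 'a) \<Rightarrow> ('k, 'a) multivector set" where
  "ext_alg scale = Modules.module.span escale (range (vprod scale))"

definition escalar ::
    "('k::field \<Rightarrow> 'a::ab_group_add \<Rightarrow> 'a) \<Rightarrow> 'k \<Rightarrow> ('k, 'a) multivector" where
  "escalar scale c = escale c (vprod scale [])"

text \<open>The bilinear extension of concatenation of products.\<close>

definition wedge ::
    "('k::field \<Rightarrow> 'a::ab_group_add \<Rightarrow> 'a) \<Rightarrow>
      ('k, 'a) multivector \<Rightarrow> ('k, 'a) multivector \<Rightarrow> ('k, 'a) multivector" where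
  "wedge scale M N =
     (\<lambda>\<omega>. if \<omega> \<in> alt_forms scale then M (\<lambda>us. N (\<lambda>ws. \<omega> (us @ ws))) else 0)"

text \<open>The linear extension of \<open>v\<^sub>1 \<and> \<dots> \<and> v\<^sub>p \<mapsto> f v\<^sub>1 \<and> \<dots> \<and> f v\<^sub>p\<close>, for linear \<open>f\<close>.\<close>

definition outermorphism ::
    "('k::field \<Rightarrow> 'a::ab_group_add \<Rightarrow> 'a) \<Rightarrow> ('a \<Rightarrow> 'a) \<Rightarrow>
      ('k, 'a) multivector \<Rightarrow> ('k, 'a) multivector" where
  "outermorphism scale f M =
     (\<lambda>\<omega>. if \<omega> \<in> alt_forms scale then M (\<lambda>vs. \<omega> (map f vs)) else 0)"

section \<open>Inner product, norm and contraction\<close>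

definition gram :: "('a \<Rightarrow> 'a \<Rightarrow> 'k::comm_ring_1) \<Rightarrow> 'a list \<Rightarrow> 'a list \<Rightarrow> 'k" where
  "gram ip vs ws = (if length vs = length ws
     then det (mat (length vs) (length vs) (\<lambda>(i, j). ip (vs ! i) (ws ! j))) else 0)"

text \<open>The extension of \<open>gram\<close> that is conjugate-linear on the left and linear on the right.
  The conjugations are there because \<open>\<lambda>vs. conjugate (gram ip vs ws)\<close> is multilinear
  in \<open>vs\<close>; \<open>gram ip vs ws\<close> itself is conjugate-linear in each entry of \<open>vs\<close>.\<close>

definition einner ::
    "('a \<Rightarrow> 'a \<Rightarrow> 'k::conjugatable_field) \<Rightarrow>
      ('k, 'a) multivector \<Rightarrow> ('k, 'a) multivector \<Rightarrow> 'k" where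
  "einner ip M N = N (\<lambda>ws. conjugate (M (\<lambda>vs. conjugate (gram ip vs ws))))"

definition enorm ::
    "('a \<Rightarrow> 'a \<Rightarrow> 'k::real_or_complex) \<Rightarrow> ('k, 'a) multivector \<Rightarrow> real" where
  "enorm ip M = sqrt (the_inv of_real (einner ip M M))"

definition lcontr ::
    "('k::conjugatable_field \<Rightarrow> 'a::ab_group_add \<Rightarrow> 'a) \<Rightarrow> ('a \<Rightarrow> 'a \<Rightarrow> 'k) \<Rightarrow>
      ('k, 'a) multivector \<Rightarrow> ('k, 'a) multivector \<Rightarrow> ('k, 'a) multivector" where
  "lcontr scale ip M N =
     (THE K. K \<in> ext_alg scale \<and>
        (\<forall>L\<in>ext_alg scale. einner ip L K = einner ip (wedge scale M L) N))"

section \<open>Blades\<close>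

definition is_blade ::
    "('k::field \<Rightarrow> 'a::ab_group_add \<Rightarrow> 'a) \<Rightarrow> nat \<Rightarrow> ('k, 'a) multivector \<Rightarrow> bool" where
  "is_blade scale p M \<longleftrightarrow>
     (if p = 0 then \<exists>c. M = escalar scale c else \<exists>vs. length vs = p \<and> M = vprod scale vs)"

text \<open>Meaningful for nonzero blades only.\<close>

definition blade_space ::
    "('k::field \<Rightarrow> 'a::ab_group_add \<Rightarrow> 'a) \<Rightarrow> ('k, 'a) multivector \<Rightarrow> 'a set" where
  "blade_space scale M = (THE V.
     (\<exists>c. M = escalar scale c \<and> V = {0}) \<or>
     (\<exists>vs. vs \<noteq> [] \<and> M = vprod scale vs \<and> V = Modules.module.span scale (set vs)))"

definition same_orientation ::
    "('k::real_normed_field, 'a) multivector \<Rightarrow> ('k, 'a) multivector \<Rightarrow> bool" where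
  "same_orientation M N \<longleftrightarrow> M \<noteq> 0 \<and> N \<noteq> 0 \<and> (\<exists>r>0. M = escale (of_real r) N)"

definition proj ::
    "('k::field \<Rightarrow> 'a::ab_group_add \<Rightarrow> 'a) \<Rightarrow> ('a \<Rightarrow> 'a \<Rightarrow> 'k) \<Rightarrow> 'a set \<Rightarrow>
      ('k, 'a) multivector \<Rightarrow> ('k, 'a) multivector" where
  "proj scale ip V = outermorphism scale (orth_proj ip V)"

definition asym_angle ::
    "('k::real_or_complex \<Rightarrow> 'a::ab_group_add \<Rightarrow> 'a) \<Rightarrow> ('a \<Rightarrow> 'a \<Rightarrow> 'k) \<Rightarrow>
      'a set \<Rightarrow> 'a set \<Rightarrow> real" where
  "asym_angle scale ip V W = (THE \<theta>. \<exists>p A. is_blade scale p A \<and> A \<noteq> 0 \<and>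
     blade_space scale A = V \<and> \<theta> = arccos (enorm ip (proj scale ip W A) / enorm ip A))"

section \<open>The encodings have the expected properties\<close>

lemma module_escale: "Modules.module (escale :: 'k::field \<Rightarrow> ('k, 'a) multivector \<Rightarrow> _)"
  by unfold_locales (auto simp: escale_def algebra_simps fun_eq_iff)

lemma ext_alg_vprod: "vprod scale vs \<in> ext_alg scale"
  unfolding ext_alg_def by (rule Modules.module.span_base[OF module_escale]) simp

lemma ext_alg_induct [consumes 1, case_names zero step]:
  fixes M :: "('k::field, 'a::ab_group_add) multivector"
  assumes "M \<in> ext_alg scale" and "P 0"
    and "\<And>c vs N. N \<in> ext_alg scale \<Longrightarrow> P N \<Longrightarrow> P (escale c (vprod scale vs) + N)"
  shows "P M"
proof -
  interpret E: Modules.module "escale :: 'k \<Rightarrow> ('k, 'a) multivector \<Rightarrow> _" by (rule module_escale)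
  have "M \<in> ext_alg scale \<and> P M" using assms(1) unfolding ext_alg_def
  proof (induction rule: E.span_induct_alt[consumes 1])
    case base
    show ?case using E.span_zero assms(2) by blast
  next
    case (step c x N)
    then obtain vs where x: "x = vprod scale vs" by blast
    have "escale c x + N \<in> E.span (range (vprod scale))"
      using step(1,2) by (auto intro: E.span_add E.span_scale[OF E.span_base])
    then show ?case using step(2) assms(3)[of N c vs] unfolding x ext_alg_def by blast
  qed
  then show ?thesis ..
qed

lemma alt_formsI:
  assumes "\<And>us ws. Vector_Spaces.linear scale (*) (\<lambda>v. \<omega> (us @ v # ws))"
    and "\<And>vs. \<not> distinct vs \<Longrightarrow> \<omega> vs = 0"
  shows "\<omega> \<in> alt_forms scale"
  using assms by (auto simp: alt_forms_def)

lemma alt_forms_append_left: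
  assumes "\<omega> \<in> alt_forms scale" shows "(\<lambda>ws. \<omega> (us @ ws)) \<in> alt_forms scale"
proof (rule alt_formsI)
  fix xs ws
  have "Vector_Spaces.linear scale (*) (\<lambda>v. \<omega> ((us @ xs) @ v # ws))"
    using assms unfolding alt_forms_def mem_Collect_eq by blast
  then show "Vector_Spaces.linear scale (*) (\<lambda>v. \<omega> (us @ xs @ v # ws))"
    unfolding append.assoc .
next
  fix vs :: "'a list" assume "\<not> distinct vs"
  then have "\<not> distinct (us @ vs)" by simp
  then show "\<omega> (us @ vs) = 0"
    using assms unfolding alt_forms_def mem_Collect_eq by blast
qed

lemma alt_forms_append_right:
  assumes "\<omega> \<in> alt_forms scale" shows "(\<lambda>us. \<omega> (us @ ws)) \<in> alt_forms scale"
proof (rule alt_formsI)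
  fix xs ys
  have "Vector_Spaces.linear scale (*) (\<lambda>v. \<omega> (xs @ v # (ys @ ws)))"
    using assms unfolding alt_forms_def mem_Collect_eq by blast
  then show "Vector_Spaces.linear scale (*) (\<lambda>v. \<omega> ((xs @ v # ys) @ ws))"
    unfolding append.assoc append_Cons .
next
  fix vs :: "'a list" assume "\<not> distinct vs"
  then have "\<not> distinct (vs @ ws)" by simp
  then show "\<omega> (vs @ ws) = 0"
    using assms unfolding alt_forms_def mem_Collect_eq by blast
qed

context vector_space
begin

lemma linear_scalar_iff:
  "Vector_Spaces.linear scale (*) f \<longleftrightarrow>
     (\<forall>x y. f (x + y) = f x + f y) \<and> (\<forall>c x. f (scale c x) = c * f x)"
proof -
  have "vector_space ((*) :: 'a \<Rightarrow> 'a \<Rightarrow> 'a)" by unfold_locales (auto simp: algebra_simps)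
  then show ?thesis using vector_space_axioms by (auto simp: Vector_Spaces.linear_iff)
qed

lemma alt_forms_iff:
  "\<omega> \<in> alt_forms scale \<longleftrightarrow>
    (\<forall>us ws x y. \<omega> (us @ (x + y) # ws) = \<omega> (us @ x # ws) + \<omega> (us @ y # ws)) \<and>
    (\<forall>us ws c x. \<omega> (us @ scale c x # ws) = c * \<omega> (us @ x # ws)) \<and>
    (\<forall>vs. \<not> distinct vs \<longrightarrow> \<omega> vs = 0)"
  unfolding alt_forms_def linear_scalar_iff by blast

lemma alt_forms_slot:
  assumes "\<omega> \<in> alt_forms scale"
  shows "\<omega> (us @ (x + y) # ws) = \<omega> (us @ x # ws) + \<omega> (us @ y # ws)"
    and "\<omega> (us @ scale c x # ws) = c * \<omega> (us @ x # ws)"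
    and "\<not> distinct vs \<Longrightarrow> \<omega> vs = 0"
  using assms unfolding alt_forms_iff by blast+

lemma alt_forms_zero: "(\<lambda>_. 0) \<in> alt_forms scale"
  unfolding alt_forms_iff by simp

lemma alt_forms_add:
  assumes "\<omega> \<in> alt_forms scale" "\<eta> \<in> alt_forms scale"
  shows "(\<lambda>vs. \<omega> vs + \<eta> vs) \<in> alt_forms scale"
  unfolding alt_forms_iff
  by (intro conjI allI impI) (simp_all add: assms[THEN alt_forms_slot(1)]
      assms[THEN alt_forms_slot(2)] assms[THEN alt_forms_slot(3)] distrib_left)

lemma alt_forms_mult:
  assumes "\<omega> \<in> alt_forms scale"
  shows "(\<lambda>vs. c * \<omega> vs) \<in> alt_forms scale"
  unfolding alt_forms_iff
  by (intro conjI allI impI)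
    (simp_all add: alt_forms_slot(1,2)[OF assms] alt_forms_slot(3)[OF assms] distrib_left)

lemma ext_alg_linear:
  assumes "M \<in> ext_alg scale" and "\<omega> \<in> alt_forms scale" and "\<eta> \<in> alt_forms scale"
  shows "M (\<lambda>vs. \<omega> vs + \<eta> vs) = M \<omega> + M \<eta>" and "M (\<lambda>vs. c * \<omega> vs) = c * M \<omega>"
  using assms(1)
  by (induction rule: ext_alg_induct)
    (simp_all add: assms(2,3) alt_forms_add alt_forms_mult vprod_def escale_def algebra_simps)

lemma ext_alg_outside: "M \<in> ext_alg scale \<Longrightarrow> \<omega> \<notin> alt_forms scale \<Longrightarrow> M \<omega> = 0"
  by (induction rule: ext_alg_induct) (simp_all add: vprod_def escale_def)

lemma alt_forms_contract:
  assumes "N \<in> ext_alg scale" and "\<omega> \<in> alt_forms scale"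
  shows "(\<lambda>us. N (\<lambda>ws. \<omega> (us @ ws))) \<in> alt_forms scale"
  using assms(1)
proof (induction rule: ext_alg_induct)
  case (step c vs N)
  have "(escale c (vprod scale vs) + N) (\<lambda>ws. \<omega> (us @ ws)) =
      c * \<omega> (us @ vs) + N (\<lambda>ws. \<omega> (us @ ws))" for us
    using alt_forms_append_left[OF assms(2), of us] by (simp add: vprod_def escale_def)
  then have eq: "(\<lambda>us. (escale c (vprod scale vs) + N) (\<lambda>ws. \<omega> (us @ ws))) =
      (\<lambda>us. c * \<omega> (us @ vs) + N (\<lambda>ws. \<omega> (us @ ws)))"
    by (intro ext)
  have "(\<lambda>us. c * \<omega> (us @ vs)) \<in> alt_forms scale"
    using alt_forms_mult[OF alt_forms_append_right[OF assms(2), of vs], of c] .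
  from alt_forms_add[OF this step(2)] show ?case unfolding eq .
qed (simp add: alt_forms_zero)

lemma vprod_not_distinct: "\<not> distinct vs \<Longrightarrow> vprod scale vs = 0"
  by (rule ext) (simp add: vprod_def alt_forms_slot(3))

lemma vprod_add:
  "vprod scale (us @ (x + y) # ws) = vprod scale (us @ x # ws) + vprod scale (us @ y # ws)"
  by (rule ext) (simp add: vprod_def alt_forms_slot(1))

lemma vprod_scale: "vprod scale (us @ scale c x # ws) = escale c (vprod scale (us @ x # ws))"
  by (rule ext) (simp add: vprod_def escale_def alt_forms_slot(2))

lemma vprod_universal:
  assumes "\<omega> \<in> alt_forms scale"
  shows "\<exists>F. (\<forall>M N. F (M + N) = F M + F N) \<and> (\<forall>c M. F (escale c M) = c * F M) \<and>
    (\<forall>vs. F (vprod scale vs) = \<omega> vs)"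
  by (rule exI[of _ "\<lambda>M. M \<omega>"]) (simp add: assms vprod_def escale_def)

lemma wedge_vprod: "wedge scale (vprod scale us) (vprod scale ws) = vprod scale (us @ ws)"
  by (auto simp: wedge_def vprod_def alt_forms_append_left alt_forms_append_right fun_eq_iff)

lemma wedge_add_left: "wedge scale (M + M') N = wedge scale M N + wedge scale M' N"
  by (auto simp: wedge_def fun_eq_iff)

lemma wedge_scale_left: "wedge scale (escale c M) N = escale c (wedge scale M N)"
  by (auto simp: wedge_def escale_def fun_eq_iff)

lemma wedge_add_right:
  assumes "M \<in> ext_alg scale" "N \<in> ext_alg scale" "N' \<in> ext_alg scale"
  shows "wedge scale M (N + N') = wedge scale M N + wedge scale M N'"
proof (rule ext)
  fix \<omega> :: "'b list \<Rightarrow> 'a"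
  show "wedge scale M (N + N') \<omega> = (wedge scale M N + wedge scale M N') \<omega>"
    using ext_alg_linear(1)[OF assms(1) alt_forms_contract[OF assms(2)] alt_forms_contract[OF assms(3)], of \<omega> \<omega>]
    by (simp add: wedge_def)
qed

lemma wedge_scale_right:
  assumes "M \<in> ext_alg scale" "N \<in> ext_alg scale"
  shows "wedge scale M (escale c N) = escale c (wedge scale M N)"
proof (rule ext)
  fix \<omega> :: "'b list \<Rightarrow> 'a"
  show "wedge scale M (escale c N) \<omega> = escale c (wedge scale M N) \<omega>"
    using ext_alg_linear(2)[OF assms(1) alt_forms_contract[OF assms(2)] alt_forms_contract[OF assms(2)], of \<omega> \<omega> c]
    by (simp add: wedge_def escale_def)
qed

lemma wedge_escalar:
  assumes "M \<in> ext_alg scale"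
  shows "wedge scale (escalar scale c) M = escale c M" "wedge scale M (escalar scale c) = escale c M"
proof -
  show *: "wedge scale (escalar scale c) M = escale c M"
    using ext_alg_outside[OF assms] alt_forms_contract[OF assms]
    by (auto simp: wedge_def escalar_def vprod_def escale_def fun_eq_iff)
  have "wedge scale M (vprod scale []) = M"
    using ext_alg_outside[OF assms]
    by (auto simp: wedge_def vprod_def fun_eq_iff alt_forms_append_left)
  then show "wedge scale M (escalar scale c) = escale c M"
    unfolding escalar_def by (simp add: wedge_scale_right assms ext_alg_vprod)
qed

lemma outermorphism_vprod:
  assumes "Vector_Spaces.linear scale scale f"
  shows "outermorphism scale f (vprod scale vs) = vprod scale (map f vs)"
proof -
  interpret f: Vector_Spaces.linear scale scale f by fact
  have "(\<lambda>vs. \<omega> (map f vs)) \<in> alt_forms scale" if "\<omega> \<in> alt_forms scale" for \<omega>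
    unfolding alt_forms_iff
    by (intro conjI allI impI)
      (simp_all add: f.add f.scale distinct_map alt_forms_slot(1,2)[OF that] alt_forms_slot(3)[OF that])
  then show ?thesis by (auto simp: outermorphism_def vprod_def fun_eq_iff)
qed

lemma outermorphism_add: "outermorphism scale f (M + N) = outermorphism scale f M + outermorphism scale f N"
  by (auto simp: outermorphism_def fun_eq_iff)

lemma outermorphism_scale: "outermorphism scale f (escale c M) = escale c (outermorphism scale f M)"
  by (auto simp: outermorphism_def escale_def fun_eq_iff)

end

context hermitian_space
begin

lemma gram_col:
  assumes "length vs = n" "length ws = n"
  shows "gram ip vs ws =
    (\<Sum>\<pi> | \<pi> permutes {0..<n}. signof \<pi> * (\<Prod>j<n. ip (vs ! \<pi> j) (ws ! j)))"
proof -
  let ?G = "mat n n (\<lambda>(i, j). ip (vs ! i) (ws ! j))"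
  have "(\<Prod>j<n. ?G $$ (\<pi> j, j)) = (\<Prod>j<n. ip (vs ! \<pi> j) (ws ! j))"
    if "\<pi> permutes {0..<n}" for \<pi>
  proof (rule prod.cong[OF refl])
    fix j assume "j \<in> {..<n}"
    then have "j < n" "\<pi> j < n" using permutes_in_image[OF that, of j] by auto
    then show "?G $$ (\<pi> j, j) = ip (vs ! \<pi> j) (ws ! j)" by simp
  qed
  then have "det ?G =
      (\<Sum>\<pi> | \<pi> permutes {0..<n}. signof \<pi> * (\<Prod>j<n. ip (vs ! \<pi> j) (ws ! j)))"
    unfolding det_col[OF mat_carrier] by (intro sum.cong refl) simp
  then show ?thesis by (simp add: gram_def assms)
qed

lemma gram_slot:
  "\<exists>K. \<forall>x. gram ip vs (us @ x # ws) =
    (\<Sum>\<pi> | \<pi> permutes {0..<length vs}. K \<pi> * ip (vs ! \<pi> (length us)) x)"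
proof (cases "length vs = length us + Suc (length ws)")
  case True
  let ?n = "length vs"
  define K where "K \<pi> = signof \<pi> *
    (\<Prod>j\<in>{..<?n} - {length us}. ip (vs ! \<pi> j) ((us @ undefined # ws) ! j))" for \<pi>
  have "(\<Prod>j<?n. ip (vs ! \<pi> j) ((us @ x # ws) ! j)) =
      ip (vs ! \<pi> (length us)) x *
      (\<Prod>j\<in>{..<?n} - {length us}. ip (vs ! \<pi> j) ((us @ undefined # ws) ! j))" for x \<pi>
  proof -
    have "(\<Prod>j<?n. ip (vs ! \<pi> j) ((us @ x # ws) ! j)) =
      ip (vs ! \<pi> (length us)) ((us @ x # ws) ! length us) *
      (\<Prod>j\<in>{..<?n} - {length us}. ip (vs ! \<pi> j) ((us @ x # ws) ! j))"
      by (rule prod.remove) (simp_all add: True)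
    also have "(us @ x # ws) ! length us = x" by simp
    also have "(\<Prod>j\<in>{..<?n} - {length us}. ip (vs ! \<pi> j) ((us @ x # ws) ! j)) =
      (\<Prod>j\<in>{..<?n} - {length us}. ip (vs ! \<pi> j) ((us @ undefined # ws) ! j))"
      by (rule prod.cong[OF refl]) (simp add: nth_append nth_Cons')
    finally show ?thesis .
  qed
  then have "gram ip vs (us @ x # ws) =
    (\<Sum>\<pi> | \<pi> permutes {0..<?n}. K \<pi> * ip (vs ! \<pi> (length us)) x)" for x
    unfolding gram_col[of vs ?n "us @ x # ws", OF refl, simplified True length_append list.size, simplified]
    by (simp add: K_def ac_simps True)
  then show ?thesis by blast
next
  case False
  then have "gram ip vs (us @ x # ws) = 0" for x by (simp add: gram_def)
  then show ?thesis by (intro exI[of _ "\<lambda>_. 0"]) simp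
qed

lemma gram_alt: "gram ip vs \<in> alt_forms scale"
  unfolding alt_forms_iff
proof (intro conjI allI impI)
  fix us ws x y
  show "gram ip vs (us @ (x + y) # ws) = gram ip vs (us @ x # ws) + gram ip vs (us @ y # ws)"
    using gram_slot[of vs us ws] by (auto simp: ip_add_right algebra_simps sum.distrib)
next
  fix us ws c x
  show "gram ip vs (us @ scale c x # ws) = c * gram ip vs (us @ x # ws)"
    using gram_slot[of vs us ws] by (auto simp: ip_scale_right sum_distrib_left mult.left_commute)
next
  fix ws :: "'a list" assume "\<not> distinct ws"
  then obtain i j where ij: "i < length ws" "j < length ws" "i \<noteq> j" "ws ! i = ws ! j"
    by (auto simp: distinct_conv_nth)
  show "gram ip vs ws = 0"
  proof (cases "length vs = length ws")
    case True
    let ?n = "length ws"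
    have "det (mat ?n ?n (\<lambda>(i, j). ip (vs ! i) (ws ! j))) = 0"
      by (rule det_identical_columns[OF mat_carrier ij(3,1,2)]) (use ij in \<open>simp add: vec_eq_iff\<close>)
    then show ?thesis by (simp add: gram_def True)
  qed (simp add: gram_def)
qed

lemma gram_commute: "gram ip ws vs = conjugate (gram ip vs ws)"
proof (cases "length vs = length ws")
  case True
  let ?n = "length ws"
  let ?G = "mat ?n ?n (\<lambda>(i, j). ip (vs ! i) (ws ! j))"
  let ?H = "mat ?n ?n (\<lambda>(i, j). ip (ws ! i) (vs ! j))"
  have conj_prod: "conjugate (prod h S) = (\<Prod>j\<in>S. conjugate (h j))" for h :: "nat \<Rightarrow> 'k" and S
    by (induction S rule: infinite_finite_induct) (auto simp: conjugate_dist_mul)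
  have conj_sign: "conjugate (signof \<pi> :: 'k) = signof \<pi>" for \<pi> :: "nat \<Rightarrow> nat"
    by (simp add: sign_def conjugate_neg)
  have "(\<Prod>j = 0..<?n. ?H $$ (j, \<pi> j)) = (\<Prod>j<?n. conjugate (ip (vs ! \<pi> j) (ws ! j)))"
    if "\<pi> permutes {0..<?n}" for \<pi>
  proof (rule prod.cong)
    fix j assume "j \<in> {..<?n}"
    then have "j < ?n" "\<pi> j < ?n" using permutes_in_image[OF that, of j] by auto
    then show "?H $$ (j, \<pi> j) = conjugate (ip (vs ! \<pi> j) (ws ! j))"
      using ip_commute[of "ws ! j" "vs ! \<pi> j"] by simp
  qed auto
  then have "det ?H = (\<Sum>\<pi> | \<pi> permutes {0..<?n}.
      signof \<pi> * (\<Prod>j<?n. conjugate (ip (vs ! \<pi> j) (ws ! j))))"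
    unfolding det_def'[OF mat_carrier] by (intro sum.cong refl) simp
  also have "\<dots> = conjugate (gram ip vs ws)"
    unfolding gram_col[OF True refl]
    by (simp add: sum_conjugate finite_permutations conjugate_dist_mul conj_prod conj_sign)
  finally show ?thesis by (simp add: gram_def True)
qed (simp add: gram_def)

lemma einner_vprod: "einner ip (vprod scale vs) (vprod scale ws) = gram ip vs ws"
proof -
  have "(\<lambda>us. conjugate (gram ip us ws')) \<in> alt_forms scale" for ws'
    using gram_alt[of ws'] by (simp add: gram_commute[symmetric])
  then show ?thesis by (simp add: einner_def vprod_def gram_alt)
qed

lemma gram_alt_conj:
  assumes "M \<in> ext_alg scale"
  shows "(\<lambda>ws. conjugate (M (\<lambda>vs. conjugate (gram ip vs ws)))) \<in> alt_forms scale"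
  using assms
proof (induction rule: ext_alg_induct)
  case (step c vs N)
  have "(\<lambda>us. conjugate (gram ip us ws)) \<in> alt_forms scale" for ws
    using gram_alt[of ws] by (simp add: gram_commute[symmetric])
  then have eq: "(\<lambda>ws. conjugate ((escale c (vprod scale vs) + N) (\<lambda>vs. conjugate (gram ip vs ws)))) =
    (\<lambda>ws. conjugate c * gram ip vs ws + conjugate (N (\<lambda>vs. conjugate (gram ip vs ws))))"
    by (simp add: vprod_def escale_def conjugate_dist_add conjugate_dist_mul)
  show ?case unfolding eq using alt_forms_add[OF alt_forms_mult[OF gram_alt] step(2)] .
qed (simp add: alt_forms_zero)

lemma einner_add_left:
  assumes "M \<in> ext_alg scale" "M' \<in> ext_alg scale" "N \<in> ext_alg scale"
  shows "einner ip (M + M') N = einner ip M N + einner ip M' N"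
  using ext_alg_linear(1)[OF assms(3) gram_alt_conj[OF assms(1)] gram_alt_conj[OF assms(2)]]
  by (simp add: einner_def conjugate_dist_add)

lemma einner_scale_left:
  assumes "M \<in> ext_alg scale" "N \<in> ext_alg scale"
  shows "einner ip (escale c M) N = conjugate c * einner ip M N"
  using ext_alg_linear(2)[OF assms(2) gram_alt_conj[OF assms(1)] gram_alt_conj[OF assms(1)]]
  by (simp add: einner_def escale_def conjugate_dist_mul)

lemma einner_add_right: "einner ip M (N + N') = einner ip M N + einner ip M N'"
  by (simp add: einner_def)

lemma einner_scale_right: "einner ip M (escale c N) = c * einner ip M N"
  by (simp add: einner_def escale_def)

end

end

theory Submission
  imports Defs
begin

text \<open>Everything is read off in orthonormal bases adapted to the two spaces. Let \<open>V = [A]\<close>,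
  \<open>W = [B]\<close> and let \<open>P\<close> be the orthogonal projection onto \<open>W\<close>. In
  \<open>\<langle>A \<and> L, B\<rangle>\<close> the entries \<open>\<langle>v, w\<rangle>\<close> of the Gram matrix with \<open>v\<close> a factor of \<open>A\<close> and \<open>w\<close> a
  factor of \<open>B\<close> do not change if \<open>v\<close> is replaced by \<open>P v\<close> (\<open>gram_proj_along\<close>), so only
  \<open>P A\<close> matters.

  If \<open>V\<close> contains a nonzero vector orthogonal to \<open>W\<close>, then \<open>A\<close> can be written with that vector as a
  factor. The Gram matrix then has a zero row for every \<open>L\<close>, hence \<open>A \<lrcorner> B = 0\<close>
  (\<open>lcontr_partially_orthogonal\<close>).

  Otherwise \<open>P\<close> is injective on \<open>V\<close>. An orthonormal basis \<open>f\<close> of \<open>P V\<close>, extended by \<open>g\<close> to an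
  orthonormal basis of \<open>W\<close>, gives \<open>P A = d F\<close> and \<open>B = b F \<and> G\<close> with nonzero scalars
  \<open>d, b\<close>, where \<open>F\<close> and \<open>G\<close> are the products of the \<open>f\<close>'s and of the \<open>g\<close>'s
  (\<open>projection_adapted_basis\<close>). The Gram matrix of \<open>F \<and> L\<close> and
  \<open>F \<and> G\<close> is block triangular with an identity block, so \<open>\<langle>F \<and> L, F \<and> G\<rangle> = \<langle>L, G\<rangle>\<close> and
  \<open>A \<lrcorner> B = d\<^sup>* b G\<close>, where \<open>d\<^sup>*\<close> is the conjugate of \<open>d\<close> (\<open>lcontr_adapted\<close>). From this formula
  the space \<open>[G] = V\<^sup>\<bottom> \<inter> W\<close>, the norm \<open>\<bar>d\<bar> \<bar>b\<bar>\<close> and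
  \<open>P A \<and> (A \<lrcorner> B) = \<bar>d\<bar>\<^sup>2 B\<close> are visible. Conversely a blade with space \<open>[G]\<close> is \<open>\<gamma> G\<close> for some scalar
  \<open>\<gamma>\<close>; the norm fixes \<open>\<bar>\<gamma>\<bar>\<close> and the orientation fixes the phase.

  Three facts about \<open>\<And>X\<close> carry this. A product of \<open>n\<close> vectors from the span of \<open>n\<close> vectors
  is a multiple of the product of the latter (\<open>vprod_top\<close>), so blades with the same space are
  proportional. Every multivector is the sum of its components along the products of the subsets of
  an orthonormal basis (\<open>ext_alg_expansion\<close>), so the inner product is positive definite;
  therefore contractions are unique and norms behave. And projecting a unit
  blade does not increase its norm (\<open>enorm_proj_le\<close>), so the quotient of the norms really is the cosine of the angle.\<close>

section \<open>Products of vectors\<close>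

interpretation mv: vector_space "escale :: 'k::field \<Rightarrow> ('k, 'a) multivector \<Rightarrow> ('k, 'a) multivector"
  by unfold_locales (auto simp: escale_def algebra_simps fun_eq_iff)

context vector_space
begin

lemma wedge_escale_right_vprod:
  "wedge scale (vprod scale us) (escale c (vprod scale ws)) = escale c (vprod scale (us @ ws))"
  by (simp add: wedge_scale_right ext_alg_vprod wedge_vprod)

lemma ext_alg_escale_vprod: "escale c (vprod scale vs) \<in> ext_alg scale"
  unfolding ext_alg_def by (intro mv.span_scale mv.span_base) simp

lemma vprod_zero_slot: "vprod scale (us @ 0 # ws) = 0"
  using vprod_scale[of us 0 0 ws] by simp

text \<open>By multilinearity the vectors \<open>x\<close> for which the product lies in \<open>S\<close> form a subspace, in each
  single slot.\<close>

lemma vprod_slot_span: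
  assumes "mv.subspace S" and "x \<in> span E"
    and "\<And>e. e \<in> E \<Longrightarrow> vprod scale (us @ e # ws) \<in> S"
  shows "vprod scale (us @ x # ws) \<in> S"
  using assms(2)
proof (induction rule: span_induct_alt)
  case base
  show ?case unfolding vprod_zero_slot using assms(1) by (rule mv.subspace_0)
next
  case (step c x y)
  then show ?case unfolding vprod_add vprod_scale
    using mv.subspace_add[OF assms(1)] mv.subspace_scale[OF assms(1)] assms(3) by blast
qed

text \<open>The engine for all reductions to basis vectors: apply the one-slot statement to the slots from
  left to right. Repeated vectors give the product \<open>0\<close>, which lies in every subspace, so that only
  distinct lists remain.\<close>

lemma vprod_in_subspace:
  assumes S: "mv.subspace S" and vs: "set vs \<subseteq> span E"
    and E: "\<And>us. set us \<subseteq> E \<Longrightarrow> length us = length vs \<Longrightarrow> distinct us \<Longrightarrow> vprod scale us \<in> S"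
  shows "vprod scale vs \<in> S"
proof -
  (* The slots in us have already been reduced to vectors from E, those in ws have not. *)
  have "vprod scale (us @ ws) \<in> S"
    if "set us \<subseteq> E" "set ws \<subseteq> span E" "length (us @ ws) = length vs" for us ws
    using that
  proof (induction ws arbitrary: us)
    case Nil
    show ?case
    proof (cases "distinct us")
      case True
      then show ?thesis using E[of us] Nil by simp
    next
      case False
      show ?thesis unfolding append_Nil2 vprod_not_distinct[OF False] using S by (rule mv.subspace_0)
    qed
  next
    case (Cons w ws)
    have "vprod scale (us @ e # ws) \<in> S" if "e \<in> E" for e
      using Cons.IH[of "us @ [e]"] Cons.prems that by simp
    then show ?case using vprod_slot_span[OF S, of w E us ws] Cons.prems(2) by simp
  qed
  from this[of "[]" vs] show ?thesis using vs by simp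
qed

lemma vprod_swap: "vprod scale (us @ x # y # ws) = escale (-1) (vprod scale (us @ y # x # ws))"
proof -
  (* Polarize: put x + y into both slots and expand. *)
  have 0: "vprod scale (us @ z # z # ws) = 0" for z
    by (rule vprod_not_distinct) simp
  have "0 = vprod scale (us @ (x + y) # (x + y) # ws)" using 0 by simp
  also have "\<dots> = vprod scale (us @ x # y # ws) + vprod scale (us @ y # x # ws)"
    using vprod_add[of us x y "(x + y) # ws"] vprod_add[of "us @ [x]" x y ws]
      vprod_add[of "us @ [y]" x y ws] by (simp add: 0)
  finally have "vprod scale (us @ x # y # ws) = - vprod scale (us @ y # x # ws)"
    by (metis add_eq_0_iff2)
  then show ?thesis by simp
qed

lemma vprod_move: "\<exists>c. vprod scale (us @ xs @ y # ws) = escale c (vprod scale (us @ y # xs @ ws))"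
proof (induction xs arbitrary: us)
  case Nil
  show ?case by (intro exI[of _ 1]) simp
next
  case (Cons x xs)
  obtain c where "vprod scale ((us @ [x]) @ xs @ y # ws) =
      escale c (vprod scale ((us @ [x]) @ y # xs @ ws))"
    using Cons.IH by blast
  then have "vprod scale (us @ (x # xs) @ y # ws) = escale (- c) (vprod scale (us @ y # (x # xs) @ ws))"
    using vprod_swap[of us x y "xs @ ws"] by simp
  then show ?case by blast
qed

text \<open>The factor is the sign of the permutation. The prefix \<open>us\<close>
  is what makes the induction work: a factor that has been moved into place joins it.\<close>

lemma vprod_permute_append:
  assumes "mset xs = mset ys"
  shows "\<exists>c. vprod scale (us @ xs) = escale c (vprod scale (us @ ys))"
  using assms
proof (induction ys arbitrary: us xs)
  case Nil
  then show ?case by (intro exI[of _ 1]) simp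
next
  case (Cons y ys)
  from Cons.prems have "y \<in> set xs"
    by (metis list.set_intros(1) set_mset_mset)
  then obtain as bs where xs: "xs = as @ y # bs" by (meson split_list)
  obtain c where c: "vprod scale (us @ xs) = escale c (vprod scale (us @ y # as @ bs))"
    using vprod_move xs by blast
  obtain d where "vprod scale ((us @ [y]) @ as @ bs) = escale d (vprod scale ((us @ [y]) @ ys))"
    using Cons.IH[of "as @ bs" "us @ [y]"] Cons.prems xs by auto
  with c show ?case by auto
qed

lemma vprod_permute:
  assumes "distinct us" "distinct vs" "set us = set vs"
  obtains c where "vprod scale us = escale c (vprod scale vs)"
  using vprod_permute_append[of us vs "[]"] assms by (auto simp: set_eq_iff_mset_eq_distinct)

text \<open>The top exterior power of a space spanned by \<open>n\<close> vectors is at most one-dimensional: after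
  reduction to basis vectors, a product of \<open>n\<close> distinct ones uses all of them, hence is a permuted
  product.\<close>

lemma vprod_top:
  assumes "length vs = length es" and "set vs \<subseteq> span (set es)"
  obtains c where "vprod scale vs = escale c (vprod scale es)"
proof -
  have "vprod scale vs \<in> range (\<lambda>c. escale c (vprod scale es))"
  proof (rule vprod_in_subspace[OF _ assms(2)])
    have "range (\<lambda>c. escale c (vprod scale es)) = mv.span {vprod scale es}"
      by (simp add: mv.span_singleton)
    then show "mv.subspace (range (\<lambda>c. escale c (vprod scale es)))" by simp
  next
    fix us assume us: "set us \<subseteq> set es" "length us = length vs" "distinct us"
    then have "card (set us) = length es" using assms(1) distinct_card by force
    moreover have "card (set es) \<le> length es" by (rule card_length)
    ultimately have eq: "set us = set es" using us(1) by (intro card_seteq) simp_all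
    then have "distinct es" using \<open>card (set us) = length es\<close> by (intro card_distinct) simp
    then obtain c where "vprod scale us = escale c (vprod scale es)"
      using vprod_permute[OF us(3) _ eq] by blast
    then show "vprod scale us \<in> range (\<lambda>c. escale c (vprod scale es))" by blast
  qed
  then show ?thesis using that by blast
qed

text \<open>If one factor depends linearly on the others, expanding it in them gives products with a
  repeated factor.\<close>

lemma vprod_nonzero_imp_independent:
  assumes "vprod scale vs \<noteq> 0"
  shows "distinct vs" "independent (set vs)"
proof -
  show d: "distinct vs" using assms vprod_not_distinct by blast
  show "independent (set vs)"
  proof
    assume "dependent (set vs)"
    then obtain a where a: "a \<in> set vs" "a \<in> span (set vs - {a})" by (auto simp: dependent_def)
    then obtain us ws where vs: "vs = us @ a # ws" by (meson split_list)
    have "vprod scale (us @ a # ws) \<in> {0}"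
    proof (rule vprod_slot_span[OF mv.subspace_single_0 a(2)])
      fix e assume "e \<in> set vs - {a}"
      then have "\<not> distinct (us @ e # ws)" by (auto simp: vs)
      then show "vprod scale (us @ e # ws) \<in> {0}" by (simp add: vprod_not_distinct)
    qed
    then show False using assms vs by simp
  qed
qed

end

section \<open>Orthonormal lists\<close>

context hermitian_space
begin

text \<open>A predicate on lists rather than on sets, because the products formed from such bases depend
  on the order of their factors.\<close>

definition orthonormal :: "'a list \<Rightarrow> bool" where
  "orthonormal es \<longleftrightarrow> distinct es \<and> (\<forall>x\<in>set es. \<forall>y\<in>set es. ip x y = (if x = y then 1 else 0))"

definition proj_along :: "'a list \<Rightarrow> 'a \<Rightarrow> 'a" where
  "proj_along es x = (\<Sum>e\<in>set es. scale (ip e x) e)"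

lemma ip_zero_right [simp]: "ip x 0 = 0"
  using ip_scale_right[of x 0 0] by simp

lemma ip_sum_right: "ip x (sum f S) = (\<Sum>i\<in>S. ip x (f i))"
  by (induction S rule: infinite_finite_induct) (simp_all add: ip_add_right)

lemma ip_diff_right: "ip x (y - z) = ip x y - ip x z"
  using ip_add_right[of x "y - z" z] by simp

lemma ip_eq_0_commute: "ip x y = 0 \<longleftrightarrow> ip y x = 0"
  using ip_commute[of x y] ip_commute[of y x] by auto

lemma ip_scale_left: "ip (scale c x) y = conjugate c * ip x y"
  by (metis ip_commute ip_scale_right conjugate_dist_mul)

lemma subspace_orth_compl: "subspace (orth_compl ip V)"
  unfolding subspace_def by (auto simp: orth_compl_def ip_add_right ip_scale_right)

lemma orth_compl_span: "orth_compl ip (span S) = orth_compl ip S"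
proof
  show "orth_compl ip (span S) \<subseteq> orth_compl ip S" by (auto simp: orth_compl_def span_base)
next
  have "S \<subseteq> orth_compl ip {x}" if "x \<in> orth_compl ip S" for x
    using that ip_eq_0_commute by (auto simp: orth_compl_def)
  then have "span S \<subseteq> orth_compl ip {x}" if "x \<in> orth_compl ip S" for x
    using that span_minimal subspace_orth_compl by blast
  then show "orth_compl ip S \<subseteq> orth_compl ip (span S)"
    using ip_eq_0_commute by (fastforce simp: orth_compl_def)
qed

lemma subspace_inter_orth_compl:
  assumes "x \<in> V" "x \<in> orth_compl ip V" shows "x = 0"
  using assms ip_pos[of x] by (force simp: orth_compl_def)

lemma normalize:
  assumes "x \<noteq> 0"
  obtains r where "ip (scale (of_real r) x) (scale (of_real r) x) = 1"
proof -
  obtain s where s: "s > 0" "ip x x = of_real s" using ip_pos[OF assms] by blast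
  have "ip (scale (of_real (1 / sqrt s)) x) (scale (of_real (1 / sqrt s)) x) =
      of_real ((1 / sqrt s) * (1 / sqrt s) * s)"
    unfolding ip_scale_left ip_scale_right s(2) conjugate_of_real of_real_mult
    by (simp only: mult.assoc)
  also have "(1 / sqrt s) * (1 / sqrt s) * s = 1"
    using s(1) by (simp add: field_simps)
  finally show ?thesis using that[of "1 / sqrt s"] by simp
qed

lemma ip_proj_along:
  assumes "orthonormal es" "e \<in> set es" shows "ip e (proj_along es x) = ip e x"
proof -
  have "ip e (proj_along es x) = (\<Sum>f\<in>set es. if e = f then ip e x else 0)"
    unfolding proj_along_def ip_sum_right ip_scale_right
    using assms by (intro sum.cong) (auto simp: orthonormal_def)
  then show ?thesis using assms(2) by simp
qed

lemma proj_along_mem: "proj_along es x \<in> span (set es)"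
  unfolding proj_along_def by (intro span_sum span_scale span_base)

lemma proj_along_orth:
  assumes "orthonormal es" shows "x - proj_along es x \<in> orth_compl ip (span (set es))"
  unfolding orth_compl_span using ip_proj_along[OF assms] by (auto simp: orth_compl_def ip_diff_right)

text \<open>Turns the projection, defined by a unique description, into the explicit sum over an
  orthonormal basis, from which linearity is evident.\<close>

lemma orth_proj_span:
  assumes "orthonormal es" shows "orth_proj ip (span (set es)) = proj_along es"
proof
  fix x
  show "orth_proj ip (span (set es)) x = proj_along es x"
    unfolding orth_proj_def
  proof (rule the_equality)
    fix v assume v: "v \<in> span (set es) \<and> x - v \<in> orth_compl ip (span (set es))"
    have "v - proj_along es x \<in> span (set es)" using v proj_along_mem span_diff by blast
    moreover have "(x - proj_along es x) - (x - v) \<in> orth_compl ip (span (set es))"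
      using subspace_diff[OF subspace_orth_compl proj_along_orth[OF assms]] v by blast
    ultimately show "v = proj_along es x"
      using subspace_inter_orth_compl[of "v - proj_along es x" "span (set es)"] by simp
  qed (use proj_along_mem proj_along_orth[OF assms] in blast)
qed

lemma linear_proj_along: "Vector_Spaces.linear scale scale (proj_along es)"
  unfolding Vector_Spaces.linear_iff using vector_space_axioms
  by (simp add: proj_along_def ip_add_right ip_scale_right scale_left_distrib sum.distrib scale_sum_right)

lemma orthonormal_imp_independent:
  assumes "orthonormal es" shows "independent (set es)"
proof
  assume "dependent (set es)"
  then obtain a where a: "a \<in> set es" "a \<in> span (set es - {a})" by (auto simp: dependent_def)
  have "a \<in> orth_compl ip (set es - {a})" using assms a(1) by (auto simp: orthonormal_def orth_compl_def)
  then have "a = 0" using a(2) subspace_inter_orth_compl orth_compl_span by metis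
  moreover have "ip a a = 1" using assms a(1) by (simp add: orthonormal_def)
  ultimately show False by simp
qed

lemma length_orthonormal:
  assumes "orthonormal es" shows "length es = dim (span (set es))"
  using assms dim_span_eq_card_independent[OF orthonormal_imp_independent[OF assms]]
  by (simp add: orthonormal_def distinct_card)

text \<open>Gram--Schmidt; the dimension of \<open>W\<close> bounds the length of the list.\<close>

lemma orthonormal_extend:
  assumes "orthonormal es" and "subspace W" and "set es \<subseteq> W"
  obtains gs where "orthonormal (es @ gs)" "span (set (es @ gs)) = W"
  using assms
proof (induction "dim W - length es" arbitrary: es thesis rule: less_induct)
  case less
  show ?case
  proof (cases "W \<subseteq> span (set es)")
    case True
    then have "span (set es) = W" using span_minimal[OF less.prems(4,3)] by blast
    then show ?thesis using less.prems(2) by (intro less.prems(1)[of "[]"]) simp_all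
  next
    case False
    then obtain w where w: "w \<in> W" "w \<notin> span (set es)" by blast
    define x where "x = w - proj_along es w"
    have x: "x \<in> orth_compl ip (span (set es))" "x \<in> W"
      using proj_along_orth[OF less.prems(2)] proj_along_mem[of es w] w(1)
        span_minimal[OF less.prems(4,3)] less.prems(3)
      by (auto simp: x_def subspace_diff)
    have "x \<noteq> 0" using w(2) proj_along_mem[of es w] by (auto simp: x_def)
    then obtain r where r: "ip (scale (of_real r) x) (scale (of_real r) x) = 1"
      using normalize by blast
    define u where "u = scale (of_real r) x"
    have u: "u \<in> orth_compl ip (span (set es))" "u \<in> W" "ip u u = 1"
      using x r less.prems(3) by (auto simp: u_def subspace_scale subspace_orth_compl)
    have orth: "ip e u = 0" "ip u e = 0" if "e \<in> set es" for e
      using u(1) that ip_eq_0_commute by (auto simp: orth_compl_def span_base)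
    then have "u \<notin> set es" using u(3) by force
    then have on: "orthonormal (es @ [u])"
      using less.prems(2) u(3) orth by (auto simp: orthonormal_def)
    have sub: "set (es @ [u]) \<subseteq> W" using u(2) less.prems(4) by simp
    have "card (set (es @ [u])) \<le> dim W"
      using independent_card_le_dim[OF sub orthonormal_imp_independent[OF on]] .
    then have "length es < dim W" using on by (simp add: orthonormal_def distinct_card del: set_append)
    then have "dim W - length (es @ [u]) < dim W - length es" by simp
    from less.hyps[OF this _ on less.prems(3) sub] obtain gs
      where "orthonormal ((es @ [u]) @ gs)" "span (set ((es @ [u]) @ gs)) = W" by blast
    then show ?thesis by (intro less.prems(1)[of "[u] @ gs"]) simp_all
  qed
qed

lemma orthonormal_Nil: "orthonormal []"
  by (simp add: orthonormal_def)

lemma orthonormal_basis: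
  assumes "subspace W"
  obtains es where "orthonormal es" "span (set es) = W"
  using orthonormal_extend[OF orthonormal_Nil assms] by auto

section \<open>Gram determinants and the inner product\<close>

lemma gram_Nil: "gram ip [] [] = 1"
  by (simp add: gram_def)

text \<open>The first row of the Gram matrix is \<open>(1, 0, \<dots>, 0)\<close>; expand the determinant along it. The
  \<open>ls\<close> play the part of an arbitrary \<open>L\<close> in \<open>\<langle>F \<and> L, F \<and> G\<rangle>\<close>, so the first column is
  arbitrary below its top entry.\<close>

lemma gram_Cons_orth:
  assumes f: "ip f f = 1" and gs: "\<And>y. y \<in> set gs \<Longrightarrow> ip f y = 0"
  shows "gram ip (f # ls) (f # gs) = gram ip ls gs"
proof (cases "length ls = length gs")
  case True
  define n where "n = length gs"
  define A where "A = mat (Suc n) (Suc n) (\<lambda>(i, j). ip ((f # ls) ! i) ((f # gs) ! j))"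
  have row: "A $$ (0, Suc j) = 0" if "j < n" for j
    using that gs by (simp add: A_def n_def)
  have "det A = (\<Sum>j<Suc n. A $$ (0, j) * cofactor A 0 j)"
    by (rule laplace_expansion_row) (simp_all add: A_def)
  also have "\<dots> = A $$ (0, 0) * cofactor A 0 0 + (\<Sum>j<n. A $$ (0, Suc j) * cofactor A 0 (Suc j))"
    by (rule sum.lessThan_Suc_shift)
  also have "\<dots> = cofactor A 0 0"
    using f row by (simp add: A_def)
  also have "\<dots> = det (mat_delete A 0 0)" by (simp add: cofactor_def)
  also have "mat_delete A 0 0 = mat n n (\<lambda>(i, j). ip (ls ! i) (gs ! j))"
    by (rule eq_matI) (simp_all add: mat_delete_def A_def)
  finally show ?thesis using True by (simp add: gram_def A_def n_def)
qed (simp add: gram_def)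

lemma gram_append_orth:
  assumes "orthonormal (fs @ gs)"
  shows "gram ip (fs @ ls) (fs @ gs) = gram ip ls gs"
  using assms
proof (induction fs)
  case (Cons f fs)
  have "gram ip (f # fs @ ls) (f # fs @ gs) = gram ip (fs @ ls) (fs @ gs)"
    using Cons.prems by (intro gram_Cons_orth) (auto simp: orthonormal_def)
  also have "\<dots> = gram ip ls gs"
    using Cons.prems by (intro Cons.IH) (auto simp: orthonormal_def)
  finally show ?case by simp
qed simp

lemma gram_orthonormal: "orthonormal es \<Longrightarrow> gram ip es es = 1"
  using gram_append_orth[of es "[]" "[]"] by (simp add: gram_Nil)

lemma vprod_orthonormal_nonzero: "orthonormal es \<Longrightarrow> vprod scale es \<noteq> 0"
  using gram_orthonormal[of es] einner_vprod[of es es] by (auto simp: einner_def)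

lemma gram_zero_column:
  assumes "y \<in> set ws" and "\<And>v. v \<in> set vs \<Longrightarrow> ip v y = 0"
  shows "gram ip vs ws = 0"
proof (cases "length vs = length ws")
  case True
  define n where "n = length ws"
  obtain j where j: "j < n" "ws ! j = y" using assms(1) by (auto simp: in_set_conv_nth n_def)
  have "(\<Prod>j<n. ip (vs ! \<pi> j) (ws ! j)) = 0" if "\<pi> permutes {0..<n}" for \<pi>
  proof -
    have "\<pi> j < n" using permutes_in_image[OF that, of j] j(1) by simp
    then have "ip (vs ! \<pi> j) (ws ! j) = 0" using assms(2) True j(2) by (simp add: n_def)
    then show ?thesis using j(1) by (intro prod_zero) auto
  qed
  then have zero: "signof \<pi> * (\<Prod>j<n. ip (vs ! \<pi> j) (ws ! j)) = 0" if "\<pi> permutes {0..<n}" for \<pi>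
    using that by simp
  have "gram ip vs ws = (\<Sum>\<pi> | \<pi> permutes {0..<n}. signof \<pi> * (\<Prod>j<n. ip (vs ! \<pi> j) (ws ! j)))"
    using True by (intro gram_col) (simp_all add: n_def)
  also have "\<dots> = 0" by (rule sum.neutral) (use zero in blast)
  finally show ?thesis .
qed (simp add: gram_def)

lemma einner_vprod_left: "einner ip (vprod scale vs) M = M (gram ip vs)"
proof -
  have "(\<lambda>us. conjugate (gram ip us ws)) \<in> alt_forms scale" for ws
    using gram_alt[of ws] by (simp add: gram_commute[symmetric])
  then show ?thesis by (simp add: einner_def vprod_def)
qed

lemma einner_vprod_right:
  assumes "M \<in> ext_alg scale"
  shows "einner ip M (vprod scale vs) = conjugate (einner ip (vprod scale vs) M)"
  unfolding einner_vprod_left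
  using gram_alt_conj[OF assms] by (simp add: einner_def vprod_def gram_commute[symmetric])

lemma einner_escale_vprod:
  "einner ip (escale a (vprod scale vs)) (escale b (vprod scale ws)) = conjugate a * b * gram ip vs ws"
  by (simp add: einner_scale_left einner_scale_right ext_alg_vprod ext_alg_escale_vprod einner_vprod)

lemma einner_zero_right: "einner ip M 0 = 0"
  by (simp add: einner_def)

lemma einner_sum_right: "einner ip M (sum F S) = (\<Sum>i\<in>S. einner ip M (F i))"
proof (induction S rule: infinite_finite_induct)
  case (insert x S)
  show ?case unfolding sum.insert[OF insert(1,2)] einner_add_right insert(3) ..
qed (simp_all only: sum.infinite sum.empty einner_zero_right not_False_eq_True)

text \<open>The products over subsets of an orthonormal basis, each subset ordered as in the basis, form an
  orthonormal basis of \<open>\<And>X\<close>. Both sides are linear in \<open>M\<close>, so it suffices to let \<open>M\<close> be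
  such a product, where orthonormality leaves one summand.\<close>

lemma ext_alg_expansion:
  assumes es: "orthonormal es" "span (set es) = UNIV" and "M \<in> ext_alg scale"
  shows "M = (\<Sum>S\<in>Pow (set es). escale (einner ip (vprod scale (filter (\<lambda>x. x \<in> S) es)) M)
    (vprod scale (filter (\<lambda>x. x \<in> S) es)))"
proof -
  define e where "e S = vprod scale (filter (\<lambda>x. x \<in> S) es)" for S
  define \<Phi> where "\<Phi> M = (\<Sum>S\<in>Pow (set es). escale (einner ip (e S) M) (e S))" for M
  have "\<Phi> 0 = 0" by (simp add: \<Phi>_def einner_zero_right del: Pow_iff)
  moreover have "\<Phi> (M + N) = \<Phi> M + \<Phi> N" for M N
    unfolding \<Phi>_def einner_add_right mv.scale_left_distrib sum.distrib ..
  moreover have "\<Phi> (escale c M) = escale c (\<Phi> M)" for c M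
    unfolding \<Phi>_def einner_scale_right mv.scale_sum_right mv.scale_scale ..
  ultimately have sub: "mv.subspace {M. \<Phi> M = M}" by (intro mv.subspaceI) auto
  have ip_es: "ip x y = 0" if "x \<in> set es" "y \<in> set es" "x \<noteq> y" for x y
    using es(1) that by (auto simp: orthonormal_def)
  have basis: "\<Phi> (e T) = e T" if T: "T \<in> Pow (set es)" for T
  proof -
    have "einner ip (e S) (e T) = (if S = T then 1 else 0)" if S: "S \<in> Pow (set es)" for S
    proof (cases "S = T")
      case True
      have "orthonormal (filter (\<lambda>x. x \<in> T) es)" using es(1) by (auto simp: orthonormal_def)
      then show ?thesis using True gram_orthonormal by (simp add: e_def einner_vprod)
    next
      case False
      let ?l = "\<lambda>S. filter (\<lambda>x. x \<in> S) es"
      have "gram ip (?l S) (?l T) = 0"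
      proof (cases "T \<subseteq> S")
        (* A proper subset has fewer elements, so the Gram determinant is 0 because the lengths
           differ; otherwise a basis vector in T - S gives a zero column. *)
        case True
        have card: "length (?l R) = card R" if "R \<in> Pow (set es)" for R
        proof -
          have "set (?l R) = R" using that by auto
          then show ?thesis using es(1) distinct_card[of "?l R"] by (simp add: orthonormal_def)
        qed
        have "finite S" using S finite_subset by auto
        then have "card T < card S" using True False by (intro psubset_card_mono) auto
        then show ?thesis using card[OF S] card[OF T] by (simp add: gram_def)
      next
        case False
        then obtain y where "y \<in> T" "y \<notin> S" by blast
        then show ?thesis using T S ip_es by (intro gram_zero_column[of y]) auto
      qed
      then show ?thesis using False by (simp add: e_def einner_vprod)
    qed
    then have "\<Phi> (e T) = (\<Sum>S\<in>Pow (set es). if S = T then e S else 0)"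
      unfolding \<Phi>_def by (intro sum.cong refl) (simp add: mv.scale_one mv.scale_zero_left)
    also have "\<dots> = e T" using T by (subst sum.delta) simp_all
    finally show ?thesis .
  qed
  have vprod: "vprod scale vs \<in> {M. \<Phi> M = M}" for vs
  proof (rule vprod_in_subspace[OF sub])
    show "set vs \<subseteq> span (set es)" using es(2) by simp
    fix us assume us: "set us \<subseteq> set es" "distinct us"
    have s: "set us = set (filter (\<lambda>x. x \<in> set us) es)" using us(1) by auto
    have d: "distinct (filter (\<lambda>x. x \<in> set us) es)" using es(1) by (simp add: orthonormal_def)
    obtain c where c: "vprod scale us = escale c (e (set us))"
      unfolding e_def by (rule vprod_permute[OF us(2) d s])
    have "e (set us) \<in> {M. \<Phi> M = M}" using basis us(1) by blast
    then show "vprod scale us \<in> {M. \<Phi> M = M}"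
      unfolding c by (rule mv.subspace_scale[OF sub])
  qed
  have "ext_alg scale \<subseteq> {M. \<Phi> M = M}"
    unfolding ext_alg_def using vprod by (intro mv.span_minimal sub) blast
  then have "\<Phi> M = M" using assms(3) by blast
  then show ?thesis unfolding \<Phi>_def e_def by (rule sym)
qed

lemma einner_nondegenerate:
  assumes "M \<in> ext_alg scale" and "\<And>vs. einner ip (vprod scale vs) M = 0"
  shows "M = 0"
proof -
  obtain es where "orthonormal es" "span (set es) = UNIV" using orthonormal_basis[OF subspace_UNIV] .
  from ext_alg_expansion[OF this assms(1)] show ?thesis
    unfolding assms(2) mv.scale_zero_left sum.neutral_const .
qed

text \<open>By the expansion this is Parseval's identity: \<open>\<langle>M, M\<rangle>\<close> is the sum of the \<open>\<bar>\<langle>e\<^sub>S, M\<rangle>\<bar>\<^sup>2\<close>.\<close>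

lemma einner_self_nonneg:
  assumes "M \<in> ext_alg scale"
  obtains r where "r \<ge> 0" "einner ip M M = of_real r"
proof -
  obtain es where "orthonormal es" "span (set es) = UNIV" using orthonormal_basis[OF subspace_UNIV] .
  note M = ext_alg_expansion[OF this assms]
  define e where "e S = vprod scale (filter (\<lambda>x. x \<in> S) es)" for S
  have "einner ip M M = einner ip M (\<Sum>S\<in>Pow (set es). escale (einner ip (e S) M) (e S))"
    using arg_cong[OF M, of "einner ip M"] unfolding e_def .
  also have "\<dots> = (\<Sum>S\<in>Pow (set es). einner ip (e S) M * conjugate (einner ip (e S) M))"
    unfolding einner_sum_right einner_scale_right e_def einner_vprod_right[OF assms] ..
  also have "\<dots> = of_real (\<Sum>S\<in>Pow (set es). (norm (einner ip (e S) M))\<^sup>2)"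
    unfolding mult_conjugate_norm of_real_sum ..
  finally show ?thesis by (rule that[rotated]) (simp add: sum_nonneg)
qed

lemma einner_self:
  assumes "M \<in> ext_alg scale"
  shows "einner ip M M = of_real ((enorm ip M)\<^sup>2)"
proof -
  obtain r where "r \<ge> 0" "einner ip M M = of_real r" using einner_self_nonneg[OF assms] .
  then show ?thesis by (simp add: enorm_def the_inv_f_f[OF inj_of_real] del: of_real_power)
qed

lemma enorm_nonneg:
  assumes "M \<in> ext_alg scale" shows "enorm ip M \<ge> 0"
proof -
  obtain r where "r \<ge> 0" "einner ip M M = of_real r" using einner_self_nonneg[OF assms] .
  then show ?thesis by (simp add: enorm_def the_inv_f_f[OF inj_of_real])
qed

lemma enorm_eqI:
  assumes "einner ip M M = of_real (r\<^sup>2)" "r \<ge> 0" shows "enorm ip M = r"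
  using assms by (simp add: enorm_def the_inv_f_f[OF inj_of_real] del: of_real_power)

lemma enorm_escale:
  assumes "M \<in> ext_alg scale" shows "enorm ip (escale c M) = norm c * enorm ip M"
proof (rule enorm_eqI)
  have "escale c M \<in> ext_alg scale"
    using assms unfolding ext_alg_def by (rule mv.span_scale)
  then have "einner ip (escale c M) (escale c M) = (c * conjugate c) * einner ip M M"
    by (simp add: einner_scale_left[OF assms assms] einner_scale_right)
  then show "einner ip (escale c M) (escale c M) = of_real ((norm c * enorm ip M)\<^sup>2)"
    unfolding mult_conjugate_norm einner_self[OF assms] by (simp add: power_mult_distrib)
qed (use enorm_nonneg[OF assms] in simp)

lemma enorm_orthonormal: "orthonormal es \<Longrightarrow> enorm ip (vprod scale es) = 1"
  by (rule enorm_eqI) (simp_all add: einner_vprod gram_orthonormal)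

text \<open>Bessel's inequality for one unit vector \<open>E\<close>: the part of \<open>M\<close> orthogonal to \<open>E\<close> has nonnegative
  norm.\<close>

lemma einner_orthonormal_le:
  assumes es: "orthonormal es" and M: "M \<in> ext_alg scale"
  shows "norm (einner ip (vprod scale es) M) \<le> enorm ip M"
proof -
  define E where "E = vprod scale es"
  define c where "c = einner ip E M"
  have E: "E \<in> ext_alg scale" by (simp add: E_def ext_alg_vprod)
  have EE: "einner ip E E = 1" by (simp add: E_def einner_vprod gram_orthonormal es)
  have cE: "escale (- c) E \<in> ext_alg scale" unfolding E_def by (rule ext_alg_escale_vprod)
  define N where "N = M + escale (- c) E"
  have N: "N \<in> ext_alg scale"
    using M cE unfolding N_def ext_alg_def by (rule mv.span_add)
  have "einner ip E N = 0"
    unfolding N_def einner_add_right einner_scale_right EE c_def[symmetric] by simp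
  then have "einner ip (M + escale (- c) E) N = einner ip M N"
    unfolding einner_add_left[OF M cE N] einner_scale_left[OF E N] by simp
  then have "einner ip N N = einner ip M N" unfolding N_def[symmetric] .
  also have "\<dots> = einner ip M M - c * conjugate c"
    unfolding N_def einner_add_right einner_scale_right E_def einner_vprod_right[OF M]
    by (simp add: c_def E_def)
  also have "\<dots> = of_real ((enorm ip M)\<^sup>2 - (norm c)\<^sup>2)"
    unfolding mult_conjugate_norm einner_self[OF M] of_real_diff ..
  finally have "(enorm ip N)\<^sup>2 = (enorm ip M)\<^sup>2 - (norm c)\<^sup>2"
    unfolding einner_self[OF N] of_real_eq_iff .
  then have "(norm c)\<^sup>2 \<le> (enorm ip M)\<^sup>2"
    using zero_le_power2[of "enorm ip N"] by linarith
  then show ?thesis unfolding c_def E_def using enorm_nonneg[OF M] by (rule power2_le_imp_le)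
qed

section \<open>Blades and their spaces\<close>

text \<open>The product of an orthonormal basis of the span is nonzero, having norm \<open>1\<close>, and it is a
  multiple of the given product.\<close>

lemma vprod_independent_nonzero:
  assumes "distinct vs" "independent (set vs)"
  shows "vprod scale vs \<noteq> 0"
proof -
  obtain es where es: "orthonormal es" "span (set es) = span (set vs)"
    using orthonormal_basis[OF subspace_span] .
  have "length es = length vs"
    using length_orthonormal[OF es(1)] es(2) dim_span_eq_card_independent[OF assms(2)]
      distinct_card[OF assms(1)] by simp
  moreover have "set es \<subseteq> span (set vs)" using es(2) span_superset by blast
  ultimately obtain c where "vprod scale es = escale c (vprod scale vs)" by (rule vprod_top)
  then show ?thesis using vprod_orthonormal_nonzero[OF es(1)] by (metis mv.scale_zero_right)
qed

text \<open>Recovers the span of the factors from the product alone, as the set of \<open>x\<close> with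
  \<open>x \<and> B = 0\<close>. This is why the space of a blade is well defined.\<close>

lemma span_eq_annihilator:
  assumes "vprod scale vs \<noteq> 0"
  shows "span (set vs) = {x. vprod scale (x # vs) = 0}"
proof -
  note vs = vprod_nonzero_imp_independent[OF assms]
  have "x \<notin> span (set vs)" if "vprod scale (x # vs) \<noteq> 0" for x
    using vprod_nonzero_imp_independent[OF that] by (simp add: independent_insert)
  moreover have "vprod scale (x # vs) \<noteq> 0" if "x \<notin> span (set vs)" for x
    using that vs span_base by (intro vprod_independent_nonzero) (auto simp: independent_insert)
  ultimately show ?thesis by blast
qed

lemma span_eq_of_vprod_multiple:
  assumes eq: "escale a (vprod scale us) = escale b (vprod scale ws)"
    and nz: "escale a (vprod scale us) \<noteq> 0"
  shows "span (set us) = span (set ws)"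
proof -
  have a: "a \<noteq> 0" "vprod scale us \<noteq> 0" using nz unfolding mv.scale_eq_0_iff by auto
  have b: "b \<noteq> 0" "vprod scale ws \<noteq> 0" using nz unfolding eq mv.scale_eq_0_iff by auto
  have "escale a (vprod scale (x # us)) = escale b (vprod scale (x # ws))" for x
    using arg_cong[OF eq, of "wedge scale (vprod scale [x])"]
    by (simp add: wedge_escale_right_vprod)
  then have "vprod scale (x # us) = 0 \<longleftrightarrow> vprod scale (x # ws) = 0" for x
    using a(1) b(1) by (metis mv.scale_eq_0_iff)
  then show ?thesis unfolding span_eq_annihilator[OF a(2)] span_eq_annihilator[OF b(2)] by blast
qed

lemma escale_vprod_Cons: "escale c (vprod scale (x # xs)) = vprod scale (scale c x # xs)"
  using vprod_scale[of "[]" c x xs] by simp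

lemma is_blade_escale_vprod: "is_blade scale (length es) (escale c (vprod scale es))"
proof (cases es)
  case (Cons x xs)
  then have "length (scale c x # xs) = length es"
    "escale c (vprod scale es) = vprod scale (scale c x # xs)"
    by (simp_all only: escale_vprod_Cons list.size)
  then have "\<exists>vs. length vs = length es \<and> escale c (vprod scale es) = vprod scale vs" by blast
  then show ?thesis using Cons unfolding is_blade_def by simp
qed (auto simp: is_blade_def escalar_def)

text \<open>The two ways of writing a blade in the definition of its space, a scalar or a product of at
  least one vector, are both multiples of a product of vectors, where a scalar has the empty
  product. So \<open>span_eq_of_vprod_multiple\<close> covers them together.\<close>

lemma blade_space_escale_vprod:
  assumes "escale c (vprod scale es) \<noteq> 0"
  shows "blade_space scale (escale c (vprod scale es)) = span (set es)"
  unfolding blade_space_def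
proof (rule the_equality)
  show "(\<exists>c'. escale c (vprod scale es) = escalar scale c' \<and> span (set es) = {0}) \<or>
    (\<exists>vs. vs \<noteq> [] \<and> escale c (vprod scale es) = vprod scale vs \<and> span (set es) = span (set vs))"
  proof (cases es)
    case (Cons x xs)
    define vs where "vs = scale c x # xs"
    have eq: "escale c (vprod scale es) = vprod scale vs"
      unfolding Cons vs_def by (rule escale_vprod_Cons)
    then have "span (set es) = span (set vs)"
      using span_eq_of_vprod_multiple[of c es 1 vs] assms unfolding mv.scale_one by blast
    then show ?thesis using eq by (auto simp: vs_def)
  qed (auto simp: escalar_def)
next
  fix V
  assume "(\<exists>c'. escale c (vprod scale es) = escalar scale c' \<and> V = {0}) \<or>
    (\<exists>vs. vs \<noteq> [] \<and> escale c (vprod scale es) = vprod scale vs \<and> V = span (set vs))"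
  then obtain c' vs where "escale c (vprod scale es) = escale c' (vprod scale vs)" "V = span (set vs)"
    unfolding escalar_def by (metis mv.scale_one span_empty list.set(1))
  then show "V = span (set es)" using span_eq_of_vprod_multiple assms by metis
qed

lemma blade_orthonormal_form:
  assumes "is_blade scale p M" "M \<noteq> 0"
  obtains es c where "orthonormal es" "length es = p" "c \<noteq> 0" "M = escale c (vprod scale es)"
proof (cases "p = 0")
  case True
  then obtain c where c: "M = escale c (vprod scale [])"
    using assms(1) by (auto simp: is_blade_def escalar_def)
  then have "c \<noteq> 0" using assms(2) mv.scale_zero_left by metis
  then show ?thesis using that[OF orthonormal_Nil _ _ c] True by simp
next
  case False
  then obtain vs where vs: "length vs = p" "M = vprod scale vs"
    using assms(1) by (auto simp: is_blade_def)
  note ind = vprod_nonzero_imp_independent[OF assms(2)[unfolded vs(2)]]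
  obtain es where es: "orthonormal es" "span (set es) = span (set vs)"
    using orthonormal_basis[OF subspace_span] .
  have len: "length vs = length es"
    using length_orthonormal[OF es(1)] es(2) dim_span_eq_card_independent[OF ind(2)]
      distinct_card[OF ind(1)] by simp
  have "set vs \<subseteq> span (set es)" using es(2) span_superset by blast
  then obtain c where c: "vprod scale vs = escale c (vprod scale es)" by (rule vprod_top[OF len])
  then have "c \<noteq> 0" using assms(2) vs(2) mv.scale_zero_left by metis
  then show ?thesis using that[OF es(1)] len vs c by metis
qed

text \<open>Blades with the same space are proportional, here to the unit blade of any chosen orthonormal
  basis.\<close>

lemma blade_in_orthonormal_basis:
  assumes "is_blade scale p M" "M \<noteq> 0" and fs: "orthonormal fs" "blade_space scale M = span (set fs)"
  obtains c where "c \<noteq> 0" "M = escale c (vprod scale fs)" "length fs = p"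
proof -
  obtain es a where es: "orthonormal es" "length es = p" "a \<noteq> 0" "M = escale a (vprod scale es)"
    using blade_orthonormal_form[OF assms(1,2)] .
  have span: "span (set es) = span (set fs)"
    using blade_space_escale_vprod[of a es] assms(2) es(4) fs(2) by simp
  then have len: "length es = length fs"
    using length_orthonormal[OF es(1)] length_orthonormal[OF fs(1)] by simp
  have "set es \<subseteq> span (set fs)" using span span_superset by blast
  with len obtain b where b: "vprod scale es = escale b (vprod scale fs)" by (rule vprod_top)
  have M: "M = escale (a * b) (vprod scale fs)" unfolding es(4) b by simp
  then have "a * b \<noteq> 0" using assms(2) by (metis mv.scale_zero_left)
  then show ?thesis using that[OF _ M] len es(2) by simp
qed

section \<open>Projections and the asymmetric angle\<close>

lemma proj_escale_vprod:
  assumes "orthonormal hs"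
  shows "proj scale ip (span (set hs)) (escale c (vprod scale vs)) =
    escale c (vprod scale (map (proj_along hs) vs))"
  unfolding proj_def orth_proj_span[OF assms] outermorphism_scale
    outermorphism_vprod[OF linear_proj_along] ..

lemma ip_proj_along_span:
  assumes "orthonormal hs" "b \<in> span (set hs)"
  shows "ip (proj_along hs v) b = ip v b"
proof -
  have "ip b (v - proj_along hs v) = 0"
    using proj_along_orth[OF assms(1)] assms(2) by (auto simp: orth_compl_def)
  then have "ip b (proj_along hs v) = ip b v" by (simp add: ip_diff_right)
  then show ?thesis by (metis ip_commute)
qed

text \<open>The entries against vectors of the span of \<open>hs\<close> do not see the part orthogonal to that span.\<close>

lemma gram_proj_along:
  assumes "orthonormal hs" "set bs \<subseteq> span (set hs)"
  shows "gram ip (map (proj_along hs) vs @ ls) bs = gram ip (vs @ ls) bs"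
proof (cases "length vs + length ls = length bs")
  case True
  have "mat (length bs) (length bs) (\<lambda>(i, j). ip ((map (proj_along hs) vs @ ls) ! i) (bs ! j)) =
    mat (length bs) (length bs) (\<lambda>(i, j). ip ((vs @ ls) ! i) (bs ! j))"
  proof (rule eq_matI)
    fix i j
    assume "i < dim_row (mat (length bs) (length bs) (\<lambda>(i, j). ip ((vs @ ls) ! i) (bs ! j)))"
      "j < dim_col (mat (length bs) (length bs) (\<lambda>(i, j). ip ((vs @ ls) ! i) (bs ! j)))"
    then have ij: "i < length bs" "j < length bs" by simp_all
    then have "bs ! j \<in> span (set hs)" using assms(2) by (meson nth_mem subsetD)
    then show "mat (length bs) (length bs) (\<lambda>(i, j). ip ((map (proj_along hs) vs @ ls) ! i) (bs ! j)) $$ (i, j) =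
      mat (length bs) (length bs) (\<lambda>(i, j). ip ((vs @ ls) ! i) (bs ! j)) $$ (i, j)"
      using ij by (simp add: nth_append ip_proj_along_span[OF assms(1)])
  qed simp_all
  then show ?thesis using True by (simp add: gram_def)
qed (simp add: gram_def)

text \<open>With \<open>E\<close> the product of \<open>es\<close>, \<open>\<parallel>P E\<parallel>\<^sup>2 = \<langle>P E, P E\<rangle> = \<langle>E, P E\<rangle> \<le> \<parallel>P E\<parallel>\<close>, since \<open>P\<close> is a self-adjoint
  idempotent and \<open>E\<close> is a unit vector.\<close>

lemma enorm_proj_le:
  assumes es: "orthonormal es" and hs: "orthonormal hs"
  shows "enorm ip (vprod scale (map (proj_along hs) es)) \<le> 1"
proof -
  define M where "M = vprod scale (map (proj_along hs) es)"
  have M: "M \<in> ext_alg scale" by (simp add: M_def ext_alg_vprod)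
  have "set (map (proj_along hs) es) \<subseteq> span (set hs)" using proj_along_mem by auto
  then have "einner ip M M = einner ip (vprod scale es) M"
    using gram_proj_along[OF hs, of _ es "[]"] by (simp add: M_def einner_vprod)
  then have "norm (einner ip M M) \<le> enorm ip M"
    using einner_orthonormal_le[OF es M] by simp
  then have "(enorm ip M)\<^sup>2 \<le> enorm ip M"
    unfolding einner_self[OF M] norm_of_real by simp
  then show ?thesis using enorm_nonneg[OF M]
    by (cases "enorm ip M = 0") (simp_all add: M_def power2_eq_square)
qed

text \<open>The angle is independent of the blade chosen to represent the first space, because any two
  differ by a scalar that cancels in the quotient.\<close>

lemma asym_angle_eq:
  assumes es: "orthonormal es"
  shows "asym_angle scale ip (span (set es)) (span (set hs)) =
    arccos (enorm ip (proj scale ip (span (set hs)) (vprod scale es)))"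
  unfolding asym_angle_def
proof (rule the_equality)
  have nz: "escale 1 (vprod scale es) \<noteq> 0"
    unfolding mv.scale_one by (rule vprod_orthonormal_nonzero[OF es])
  then have "blade_space scale (vprod scale es) = span (set es)"
    using blade_space_escale_vprod[OF nz] by (simp only: mv.scale_one)
  moreover have "is_blade scale (length es) (vprod scale es)"
    using is_blade_escale_vprod[of es 1] by (simp only: mv.scale_one)
  ultimately show "\<exists>p A. is_blade scale p A \<and> A \<noteq> 0 \<and> blade_space scale A = span (set es) \<and>
      arccos (enorm ip (proj scale ip (span (set hs)) (vprod scale es))) =
      arccos (enorm ip (proj scale ip (span (set hs)) A) / enorm ip A)"
    using vprod_orthonormal_nonzero[OF es] enorm_orthonormal[OF es]
    by (intro exI[of _ "length es"] exI[of _ "vprod scale es"]) simp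
next
  fix \<theta>
  assume "\<exists>p A. is_blade scale p A \<and> A \<noteq> 0 \<and> blade_space scale A = span (set es) \<and>
    \<theta> = arccos (enorm ip (proj scale ip (span (set hs)) A) / enorm ip A)"
  then obtain p A where A: "is_blade scale p A" "A \<noteq> 0" "blade_space scale A = span (set es)"
    and \<theta>: "\<theta> = arccos (enorm ip (proj scale ip (span (set hs)) A) / enorm ip A)" by blast
  obtain c where c: "c \<noteq> 0" "A = escale c (vprod scale es)"
    using blade_in_orthonormal_basis[OF A(1,2) es A(3)] .
  obtain ks where ks: "orthonormal ks" "span (set ks) = span (set hs)"
    using orthonormal_basis[OF subspace_span] .
  have "enorm ip (proj scale ip (span (set ks)) A) =
      norm c * enorm ip (proj scale ip (span (set ks)) (vprod scale es))"
    using proj_escale_vprod[OF ks(1), of c es] proj_escale_vprod[OF ks(1), of 1 es]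
    unfolding c(2) mv.scale_one by (simp only: enorm_escale ext_alg_vprod)
  then show "\<theta> = arccos (enorm ip (proj scale ip (span (set hs)) (vprod scale es)))"
    using c(1) enorm_orthonormal[OF es] ks(2) unfolding \<theta> by (simp add: c(2) enorm_escale ext_alg_vprod)
qed

section \<open>The contraction of blades\<close>

text \<open>By linearity in \<open>L\<close> the defining property of the contraction only has to be tested on
  products of vectors. Uniqueness is nondegeneracy of the inner product.\<close>

lemma lcontr_vprod_eqI:
  assumes K: "K \<in> ext_alg scale"
    and eq: "\<And>ls. einner ip (vprod scale ls) K = einner ip (escale a (vprod scale (vs @ ls))) N"
    and N: "N \<in> ext_alg scale"
  shows "lcontr scale ip (escale a (vprod scale vs)) N = K"
  unfolding lcontr_def
proof (rule the_equality)
  have wedge: "wedge scale (escale a (vprod scale vs)) (vprod scale ls) = escale a (vprod scale (vs @ ls))" for ls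
    by (simp only: wedge_scale_left wedge_vprod)
  have "wedge scale (escale a (vprod scale vs)) L \<in> ext_alg scale \<and>
      einner ip L K = einner ip (wedge scale (escale a (vprod scale vs)) L) N"
    if "L \<in> ext_alg scale" for L
    using that
  proof (induction rule: ext_alg_induct)
    case zero
    have "einner ip 0 M = 0" if "M \<in> ext_alg scale" for M
      using einner_scale_left[OF ext_alg_vprod that, of 0 "[]"] by (simp only: mv.scale_zero_left conjugate_zero mult_zero_left)
    moreover have "wedge scale (escale a (vprod scale vs)) 0 = 0"
      using wedge_escale_right_vprod[of vs 0 "[]"] by (simp only: wedge_scale_left mv.scale_zero_left mv.scale_zero_right)
    moreover have "0 \<in> ext_alg scale" unfolding ext_alg_def by (rule mv.span_zero)
    ultimately show ?case by (simp only: K N)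
  next
    case (step c ls L)
    let ?A = "escale a (vprod scale vs)"
    have L: "L \<in> ext_alg scale" by fact
    have "wedge scale ?A (escale c (vprod scale ls) + L) =
        escale c (escale a (vprod scale (vs @ ls))) + wedge scale ?A L"
      unfolding wedge_add_right[OF ext_alg_escale_vprod ext_alg_escale_vprod L]
        wedge_scale_right[OF ext_alg_escale_vprod ext_alg_vprod] wedge ..
    moreover have "escale c (escale a (vprod scale (vs @ ls))) \<in> ext_alg scale"
      unfolding mv.scale_scale by (rule ext_alg_escale_vprod)
    moreover from this have "escale c (escale a (vprod scale (vs @ ls))) + wedge scale ?A L \<in> ext_alg scale"
      using step.IH unfolding ext_alg_def by (blast intro: mv.span_add)
    ultimately show ?case
      using step.IH
      by (simp only: einner_add_left[OF ext_alg_escale_vprod L K] einner_add_left[OF _ _ N]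
          einner_scale_left[OF ext_alg_vprod K] einner_scale_left[OF ext_alg_escale_vprod N] eq)
  qed
  then show "K \<in> ext_alg scale \<and> (\<forall>L\<in>ext_alg scale.
      einner ip L K = einner ip (wedge scale (escale a (vprod scale vs)) L) N)" using K by blast
  fix K'
  assume K': "K' \<in> ext_alg scale \<and> (\<forall>L\<in>ext_alg scale.
      einner ip L K' = einner ip (wedge scale (escale a (vprod scale vs)) L) N)"
  have "K' + escale (-1) K = 0"
  proof (rule einner_nondegenerate)
    show "K' + escale (-1) K \<in> ext_alg scale"
      using K K' mv.span_add mv.span_scale unfolding ext_alg_def by blast
    show "einner ip (vprod scale ls) (K' + escale (-1) K) = 0" for ls
      using K' ext_alg_vprod[of scale ls] unfolding einner_add_right einner_scale_right eq wedge[symmetric] by simp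
  qed
  then show "K' = K" by (simp only: mv.scale_minus_left mv.scale_one add_eq_0_iff2 minus_minus)
qed

text \<open>Normalize a nonzero vector of the first space that is orthogonal to the second, and complete
  it to an orthonormal basis of the first.\<close>

lemma lcontr_partially_orthogonal:
  assumes es: "orthonormal es" and hs: "orthonormal hs" and "a \<noteq> 0"
    and po: "partially_orthogonal ip (span (set es)) (span (set hs))"
  shows "lcontr scale ip (escale a (vprod scale es)) (escale b (vprod scale hs)) = 0"
proof -
  let ?A = "escale a (vprod scale es)"
  have A: "?A \<noteq> 0" using vprod_orthonormal_nonzero[OF es] assms(3) unfolding mv.scale_eq_0_iff by blast
  have "0 \<in> orth_compl ip (span (set hs)) \<inter> span (set es)"
    using subspace_0[OF subspace_orth_compl] span_zero by blast
  then obtain x where x: "x \<noteq> 0" "x \<in> span (set es)" "x \<in> orth_compl ip (span (set hs))"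
    using po unfolding partially_orthogonal_def by blast
  obtain r where r: "ip (scale (of_real r) x) (scale (of_real r) x) = 1" using normalize[OF x(1)] by blast
  define u where "u = scale (of_real r) x"
  have u: "u \<in> span (set es)" "u \<in> orth_compl ip (span (set hs))" "ip u u = 1"
    using x r by (auto simp: u_def span_scale subspace_scale subspace_orth_compl)
  have "orthonormal [u]" using u(3) by (simp add: orthonormal_def)
  then obtain gs where gs: "orthonormal ([u] @ gs)" "span (set ([u] @ gs)) = span (set es)"
    using orthonormal_extend[OF _ subspace_span, of "[u]" "set es"] u(1) by auto
  define us where "us = [u] @ gs"
  obtain c where c: "?A = escale c (vprod scale us)"
    using blade_in_orthonormal_basis[OF is_blade_escale_vprod A gs(1)] blade_space_escale_vprod[OF A] gs(2)
    by (metis us_def)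
  have "gram ip (us @ ls) hs = 0" for ls
  proof -
    have "ip h u = 0" if "h \<in> set hs" for h using u(2) that by (auto simp: orth_compl_def span_base)
    then have "gram ip hs (us @ ls) = 0" by (intro gram_zero_column[of u]) (simp_all add: us_def)
    then show ?thesis using gram_commute[of "us @ ls" hs] by simp
  qed
  then show ?thesis
    unfolding c by (intro lcontr_vprod_eqI ext_alg_escale_vprod)
      (simp_all only: einner_escale_vprod einner_zero_right mult_zero_right,
        unfold ext_alg_def, rule mv.span_zero)
qed

text \<open>Here \<open>fs\<close> is an orthonormal basis of the projection of the first space and \<open>gs\<close> completes it
  inside the second. On the second space, orthogonality to the first space is the same as
  orthogonality to its projection, which explains the last conclusion.\<close>

lemma projection_adapted_basis:
  assumes es: "orthonormal es" and hs: "orthonormal hs"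
    and npo: "\<not> partially_orthogonal ip (span (set es)) (span (set hs))"
  obtains fs gs c where "orthonormal (fs @ gs)" "span (set (fs @ gs)) = span (set hs)"
    "length fs = length es" "c \<noteq> 0"
    "vprod scale (map (proj_along hs) es) = escale c (vprod scale fs)"
    "span (set gs) = orth_compl ip (span (set es)) \<inter> span (set hs)"
proof -
  let ?P = "proj_along hs"
  define ts where "ts = map ?P es"
  interpret P: Vector_Spaces.linear scale scale ?P by (rule linear_proj_along)
  have inj: "inj_on ?P (span (set es))"
  proof (rule inj_onI)
    fix x y assume xy: "x \<in> span (set es)" "y \<in> span (set es)" "?P x = ?P y"
    have "x - y - ?P (x - y) \<in> orth_compl ip (span (set hs))" by (rule proj_along_orth[OF hs])
    then have "x - y \<in> orth_compl ip (span (set hs)) \<inter> span (set es)"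
      using xy by (simp add: P.diff span_diff)
    then have "x - y \<in> {0}" using npo unfolding partially_orthogonal_def by blast
    then show "x = y" by simp
  qed
  have "independent (set ts)"
    unfolding ts_def set_map
    using orthonormal_imp_independent[OF es] inj by (rule P.independent_injective_image)
  moreover have "distinct ts"
    using es inj_on_subset[OF inj span_superset] by (simp add: ts_def distinct_map orthonormal_def)
  ultimately have ts: "vprod scale ts \<noteq> 0" "length ts = dim (span (set ts))"
    using vprod_independent_nonzero dim_span_eq_card_independent distinct_card by metis+
  obtain fs where fs: "orthonormal fs" "span (set fs) = span (set ts)"
    using orthonormal_basis[OF subspace_span] .
  have len: "length ts = length fs" unfolding ts(2) length_orthonormal[OF fs(1)] fs(2) ..
  have "set ts \<subseteq> span (set fs)" using fs(2) span_superset by blast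
  with len obtain c where c: "vprod scale ts = escale c (vprod scale fs)" by (rule vprod_top)
  then have "c \<noteq> 0" using ts(1) mv.scale_zero_left by metis
  have "span (set ts) \<subseteq> span (set hs)"
    by (intro span_minimal) (auto simp: ts_def proj_along_mem)
  then have "set fs \<subseteq> span (set hs)" using fs(2) span_superset by blast
  then obtain gs where gs: "orthonormal (fs @ gs)" "span (set (fs @ gs)) = span (set hs)"
    using orthonormal_extend[OF fs(1) subspace_span] by blast
  have orth: "ip f g = 0" if "f \<in> set fs" "g \<in> set gs" for f g
    using gs(1) that by (auto simp: orthonormal_def)
  have "span (set gs) = orth_compl ip (set fs) \<inter> span (set hs)"
  proof
    have "set gs \<subseteq> orth_compl ip (set fs)" using orth by (auto simp: orth_compl_def)
    moreover have "set gs \<subseteq> span (set hs)" using gs(2) span_superset[of "set (fs @ gs)"] by simp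
    ultimately show "span (set gs) \<subseteq> orth_compl ip (set fs) \<inter> span (set hs)"
      by (intro span_minimal) (auto simp: subspace_inter subspace_orth_compl)
    have on: "orthonormal gs" using gs(1) by (simp add: orthonormal_def)
    show "orth_compl ip (set fs) \<inter> span (set hs) \<subseteq> span (set gs)"
    proof
      fix w assume w: "w \<in> orth_compl ip (set fs) \<inter> span (set hs)"
      have Pw: "proj_along gs w \<in> orth_compl ip (set fs) \<inter> span (set hs)"
        using \<open>span (set gs) \<subseteq> _\<close> proj_along_mem by blast
      have "w - proj_along gs w \<in> orth_compl ip (set fs)"
        using w Pw by (auto intro: subspace_diff[OF subspace_orth_compl])
      moreover have "w - proj_along gs w \<in> orth_compl ip (set gs)"
        using proj_along_orth[OF on] unfolding orth_compl_span .
      ultimately have "w - proj_along gs w \<in> orth_compl ip (span (set (fs @ gs)))"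
        unfolding orth_compl_span by (auto simp: orth_compl_def)
      moreover have "w - proj_along gs w \<in> span (set (fs @ gs))"
        unfolding gs(2) using w Pw by (simp add: span_diff)
      ultimately have "w = proj_along gs w" using subspace_inter_orth_compl by force
      then show "w \<in> span (set gs)" using proj_along_mem by metis
    qed
  qed
  moreover have "w \<in> orth_compl ip (set fs) \<longleftrightarrow> w \<in> orth_compl ip (span (set es))"
    if w: "w \<in> span (set hs)" for w
  proof -
    have "w \<in> orth_compl ip (set fs) \<longleftrightarrow> w \<in> orth_compl ip (set ts)"
      using fs(2) orth_compl_span by metis
    also have "\<dots> \<longleftrightarrow> w \<in> orth_compl ip (set es)"
      by (simp add: orth_compl_def ts_def ip_proj_along_span[OF hs w])
    finally show ?thesis unfolding orth_compl_span .
  qed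
  ultimately have "span (set gs) = orth_compl ip (span (set es)) \<inter> span (set hs)" by blast
  then show ?thesis using that[OF gs _ \<open>c \<noteq> 0\<close>] c len by (simp add: ts_def)
qed

text \<open>Projecting the factors of \<open>A\<close> leaves the Gram determinants with \<open>B\<close> unchanged and turns them
  into \<open>c\<^sup>* \<langle>F \<and> L, F \<and> G\<rangle> = c\<^sup>* \<langle>L, G\<rangle>\<close>. The conjugates come from the left entry of the inner product.\<close>

lemma lcontr_adapted:
  assumes hs: "orthonormal hs" and fg: "orthonormal (fs @ gs)" "span (set (fs @ gs)) = span (set hs)"
    and c: "vprod scale (map (proj_along hs) es) = escale c (vprod scale fs)"
  shows "lcontr scale ip (escale a (vprod scale es)) (escale b (vprod scale (fs @ gs))) =
    escale (conjugate (a * c) * b) (vprod scale gs)"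
proof (intro lcontr_vprod_eqI ext_alg_escale_vprod)
  fix ls
  have sub: "set (fs @ gs) \<subseteq> span (set hs)" using fg(2) span_superset by metis
  have "vprod scale (map (proj_along hs) es @ ls) = escale c (vprod scale (fs @ ls))"
    by (simp only: c wedge_scale_left flip: wedge_vprod)
  then have "gram ip (map (proj_along hs) es @ ls) (fs @ gs) = conjugate c * gram ip (fs @ ls) (fs @ gs)"
    using einner_vprod[of "map (proj_along hs) es @ ls" "fs @ gs"]
    by (simp add: einner_scale_left ext_alg_vprod einner_vprod)
  then have "gram ip (es @ ls) (fs @ gs) = conjugate c * gram ip ls gs"
    unfolding gram_proj_along[OF hs sub] gram_append_orth[OF fg(1)] .
  then show "einner ip (vprod scale ls) (escale (conjugate (a * c) * b) (vprod scale gs)) =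
      einner ip (escale a (vprod scale (es @ ls))) (escale b (vprod scale (fs @ gs)))"
    unfolding einner_escale_vprod unfolding einner_scale_right einner_vprod
    by (simp add: conjugate_dist_mul ac_simps)
qed

end

theorem theorem3p26:
  fixes scale :: "'k::real_or_complex \<Rightarrow> 'a::ab_group_add \<Rightarrow> 'a"
    and Basis :: "'a set"
    and ip :: "'a \<Rightarrow> 'a \<Rightarrow> 'k"
    and A B :: "('k, 'a) multivector"
    and p q :: nat
  assumes "hermitian_space scale Basis ip"
    and "is_blade scale p A" and "A \<noteq> 0"
    and "is_blade scale q B" and "B \<noteq> 0"
  shows "(lcontr scale ip A B = 0 \<longleftrightarrow>
      partially_orthogonal ip (blade_space scale A) (blade_space scale B)) \<and>
    (lcontr scale ip A B \<noteq> 0 \<longrightarrow>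
      p \<le> q \<and>
      (\<forall>C.
        is_blade scale (q - p) C \<and>
        blade_space scale C = orth_compl ip (blade_space scale A) \<inter> blade_space scale B \<and>
        enorm ip C = enorm ip (proj scale ip (blade_space scale B) A) * enorm ip B \<and>
        enorm ip C = enorm ip A * enorm ip B *
          cos (asym_angle scale ip (blade_space scale A) (blade_space scale B)) \<and>
        same_orientation (wedge scale (proj scale ip (blade_space scale B) A) C) B
        \<longleftrightarrow> C = lcontr scale ip A B))"
proof -
  interpret hermitian_space scale Basis ip by fact
  note A = assms(2,3) and B = assms(4,5)
  obtain es a where es: "orthonormal es" "length es = p" "a \<noteq> 0" "A = escale a (vprod scale es)"
    using blade_orthonormal_form[OF A] .
  obtain hs b' where hs: "orthonormal hs" "length hs = q" "b' \<noteq> 0" "B = escale b' (vprod scale hs)"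
    using blade_orthonormal_form[OF B] .
  have spA: "blade_space scale A = span (set es)"
    using blade_space_escale_vprod A(2) unfolding es(4) .
  have spB: "blade_space scale B = span (set hs)"
    using blade_space_escale_vprod B(2) unfolding hs(4) .
  show ?thesis
  proof (cases "partially_orthogonal ip (span (set es)) (span (set hs))")
    case True
    then show ?thesis
      using lcontr_partially_orthogonal[OF es(1) hs(1) es(3), of b'] spA spB es(4) hs(4) by simp
  next
    case False
    obtain fs gs c where fg: "orthonormal (fs @ gs)" "span (set (fs @ gs)) = span (set hs)"
      and len: "length fs = length es" and c: "c \<noteq> 0"
      and Pes: "vprod scale (map (proj_along hs) es) = escale c (vprod scale fs)"
      and gs: "span (set gs) = orth_compl ip (span (set es)) \<inter> span (set hs)"
      using projection_adapted_basis[OF es(1) hs(1) False] .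
    obtain b where b: "b \<noteq> 0" "B = escale b (vprod scale (fs @ gs))" "length (fs @ gs) = q"
      using blade_in_orthonormal_basis[OF B fg(1)] spB fg(2) by metis
    have on: "orthonormal fs" "orthonormal gs" using fg(1) by (simp_all add: orthonormal_def)
    have lens: "p \<le> q" "length gs = q - p" using b(3) len es(2) by auto
    define d where "d = a * c"
    have d: "d \<noteq> 0" using es(3) c by (simp add: d_def)
    have K: "lcontr scale ip A B = escale (conjugate d * b) (vprod scale gs)"
      unfolding es(4) b(2) d_def by (rule lcontr_adapted[OF hs(1) fg Pes])
    have PA: "proj scale ip (span (set hs)) A = escale d (vprod scale fs)"
      unfolding es(4) proj_escale_vprod[OF hs(1)] Pes d_def by (rule mv.scale_scale)
    have nA: "enorm ip A = norm a" and nB: "enorm ip B = norm b"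
      and nPA: "enorm ip (escale d (vprod scale fs)) = norm d"
      unfolding es(4) b(2) by (simp_all only: enorm_escale ext_alg_vprod enorm_orthonormal es(1) fg(1) on mult_1_right)
    have nG: "enorm ip (escale \<gamma> (vprod scale gs)) = norm \<gamma>" for \<gamma>
      by (simp only: enorm_escale ext_alg_vprod enorm_orthonormal on mult_1_right)
    have nP: "enorm ip (vprod scale (map (proj_along hs) es)) = norm c"
      unfolding Pes by (simp only: enorm_escale ext_alg_vprod enorm_orthonormal on mult_1_right)
    have "proj scale ip (span (set hs)) (vprod scale es) = vprod scale (map (proj_along hs) es)"
      using proj_escale_vprod[OF hs(1), of 1 es] unfolding mv.scale_one .
    then have "asym_angle scale ip (span (set es)) (span (set hs)) = arccos (norm c)"
      using asym_angle_eq[OF es(1), of hs] nP by simp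
    moreover have "norm c \<le> 1" using enorm_proj_le[OF es(1) hs(1)] nP by simp
    ultimately have cos: "cos (asym_angle scale ip (span (set es)) (span (set hs))) = norm c"
      by (simp add: cos_arccos order_trans[OF _ norm_ge_zero])
    have nz: "conjugate d * b \<noteq> 0" using d b(1) by simp
    have G: "escale \<gamma> (vprod scale gs) = 0 \<longleftrightarrow> \<gamma> = 0" for \<gamma>
      using vprod_orthonormal_nonzero[OF on(2)] by (simp only: mv.scale_eq_0_iff) blast
    have FG: "vprod scale (fs @ gs) \<noteq> 0" by (rule vprod_orthonormal_nonzero[OF fg(1)])
    have wedge: "wedge scale (escale d (vprod scale fs)) (escale \<gamma> (vprod scale gs)) =
        escale (d * \<gamma>) (vprod scale (fs @ gs))" for \<gamma>
      by (simp only: wedge_scale_left wedge_escale_right_vprod mv.scale_scale)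
    (* For multiples of G the orientation condition is a condition on scalars. *)
    have orient: "same_orientation (wedge scale (escale d (vprod scale fs)) (escale \<gamma> (vprod scale gs))) B
        \<longleftrightarrow> (\<exists>r>0. d * \<gamma> = of_real r * b)" for \<gamma>
    proof -
      have "d * \<gamma> \<noteq> 0" if "r > 0" "d * \<gamma> = of_real r * b" for r
        using that b(1) by simp
      then show ?thesis
        using B(2) FG unfolding same_orientation_def wedge
        unfolding b(2) mv.scale_scale mv.scale_cancel_right mv.scale_eq_0_iff by blast
    qed
    have "is_blade scale (q - p) C \<and>
        blade_space scale C = orth_compl ip (span (set es)) \<inter> span (set hs) \<and>
        enorm ip C = norm d * norm b \<and> enorm ip C = norm a * norm b * norm c \<and>
        same_orientation (wedge scale (escale d (vprod scale fs)) C) B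
        \<longleftrightarrow> C = escale (conjugate d * b) (vprod scale gs)" (is "?P C \<longleftrightarrow> _") for C
    proof
      assume C: "?P C"
      have "wedge scale (escale d (vprod scale fs)) 0 = 0"
        using wedge[of 0] by (simp only: mv.scale_zero_left mult_zero_right)
      then have "C \<noteq> 0" using C by (auto simp: same_orientation_def)
      then obtain \<gamma> where \<gamma>: "C = escale \<gamma> (vprod scale gs)"
        using blade_in_orthonormal_basis[OF _ _ on(2)] C gs by metis
      then obtain r where r: "r > 0" "d * \<gamma> = of_real r * b" using C orient by blast
      have "norm \<gamma> = norm d * norm b" using C nG unfolding \<gamma> by simp
      moreover have "norm d * norm \<gamma> = r * norm b"
        using arg_cong[OF r(2), of norm] r(1) by (simp add: norm_mult)
      (* The two norm equations determine the positive factor r, and then the phase of \<gamma>. *)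
      ultimately have "r = (norm d)\<^sup>2" using b(1) by (simp add: power2_eq_square)
      then have "d * \<gamma> = d * (conjugate d * b)"
        using r(2) mult_conjugate_norm[of d] by (simp add: mult.assoc[symmetric])
      then show "C = escale (conjugate d * b) (vprod scale gs)" using d \<gamma> by simp
    next
      assume C: "C = escale (conjugate d * b) (vprod scale gs)"
      have "is_blade scale (q - p) C" using is_blade_escale_vprod[of gs] lens(2) C by metis
      moreover have "blade_space scale C = span (set gs)"
        unfolding C using nz G by (intro blade_space_escale_vprod) blast
      moreover have "norm (conjugate d) = norm d"
      proof -
        have "norm d * norm (conjugate d) = norm d * norm d"
          using arg_cong[OF mult_conjugate_norm[of d], of norm]
          by (simp add: norm_mult power2_eq_square)
        then show ?thesis using d by simp
      qed
      then have "enorm ip C = norm d * norm b" "enorm ip C = norm a * norm b * norm c"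
        unfolding C nG by (simp_all add: norm_mult d_def)
      moreover have "d * (conjugate d * b) = of_real ((norm d)\<^sup>2) * b"
        unfolding mult_conjugate_norm[symmetric] by (simp only: mult.assoc)
      then have "\<exists>r>0. d * (conjugate d * b) = of_real r * b"
        using d by (intro exI[of _ "(norm d)\<^sup>2"]) simp
      then have "same_orientation (wedge scale (escale d (vprod scale fs)) C) B"
        unfolding C orient .
      ultimately show "?P C" unfolding gs by blast
    qed
    moreover have "lcontr scale ip A B \<noteq> 0" unfolding K G by (rule nz)
    ultimately show ?thesis
      using False lens(1) unfolding spA spB PA nA nB nPA cos unfolding K by blast
  qed
qed

end
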